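(* Let $r\geq 3$ and $\alpha\in(0,1/r)$. Then $n^{-2/r}$ is a threshold function of $\mathcal{G}_r(\alpha)$ for the property of having a perfect $K_r$-tiling. That is, there exist real constants $c,C>0$ such that: (1) if $p=p(n)\geq C n^{-2/r}$, then for every sequence $(G_n)$ with $G_n\in\mathcal{G}_r(\alpha;n)$, the graph $G_n\cup G_r(n,p)$ contains a perfect $K_r$-tiling with high probability; (2) if $p=p(n)\leq c n^{-2/r}$, then there exists a sequence $(G_n^* )$ with $G_n^*\in\mathcal{G}_r(\alpha;n)$ such that, with high probability, $G_n^*\cup G_r(n,p)$ does not contain a perfect $K_r$-tiling.
   Context: A balanced $r$-partite graph $G=(V_1\sqcup\cdots\sqcup V_r;E)$ on $rn$ vertices has $|V_1|=\cdots=|V_r|=n$, each $V_i$ independent. Define $\delta^*(G)=\min_{i\neq j\in[r]}\delta(G[V_i,V_j])$, where $G[V_i,V_j]$ is the bipartite subgraph of edges between $V_i$ and $V_j$. $\mathcal{G}_r(\alpha;n)$ is the set of balanced $r$-partite graphs on $rn$ vertices with $\delta^*(G)\geq\alpha n$, and $\mathcal{G}_r(\alpha)=\bigcup_n\mathcal{G}_r(\alpha;n)$. $G_r(n,p)$ is the random graph on the same vertex partition $V_1\sqcup\cdots\sqcup V_r$ in which each pair of vertices from distinct classes is an edge independently with probability $p$ (no edges inside a class). $G_n\cup G_r(n,p)$ is the union of the edge sets on the common vertex set. A perfect $K_r$-tiling is a collection of vertex-disjoint copies of $K_r$ covering all vertices. "With high probability" means with probability tending to $1$ as $n\to\infty$.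 A function $t(n)$ is a threshold function of a class $\mathcal{G}_r$ for a monotone property $P$ if there are constants $c,C>0$ such that $p\ge Ct(n)$ implies that for every sequence $(G_n)\subseteq\mathcal{G}_r$, $G_n\cup G_r(n,p)$ has $P$ whp, and $p\le ct(n)$ implies there is a sequence $(G_n^* )\subseteq\mathcal{G}_r$ such that $G_n^*\cup G_r(n,p)$ does not have $P$ whp. *)

theory Defs
  imports "HOL-Probability.Probability"
begin

type_synonym vertex = "nat \<times> nat"

definition vclass :: "nat \<Rightarrow> nat \<Rightarrow> vertex set" where
  "vclass n i = {i} \<times> {..<n}"

definition verts :: "nat \<Rightarrow> nat \<Rightarrow> vertex set" where
  "verts r n = (\<Union>i<r. vclass n i)"

text \<open>Graphs on the fixed vertex set \<open>verts r n\<close> are represented by their edge sets, an edge being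
  a two-element set of vertices. The balanced \<open>r\<close>-partite graphs with classes
  \<open>vclass n 0, \<dots>, vclass n (r - 1)\<close> are thus the subsets of \<open>cross_pairs r n\<close>.\<close>

definition cross_pairs :: "nat \<Rightarrow> nat \<Rightarrow> vertex set set" where
  "cross_pairs r n =
     {{u, v} | u v i j. i < r \<and> j < r \<and> i \<noteq> j \<and> u \<in> vclass n i \<and> v \<in> vclass n j}"

definition edges_between :: "'a set set \<Rightarrow> 'a set \<Rightarrow> 'a set \<Rightarrow> 'a set set" where
  "edges_between E A B = {e \<in> E. \<exists>a\<in>A. \<exists>b\<in>B. e = {a, b}}"

definition vertex_degree :: "'a set set \<Rightarrow> 'a \<Rightarrow> nat" where
  "vertex_degree E v = card {e \<in> E. v \<in> e}"

definition min_degree :: "'a set \<Rightarrow> 'a set set \<Rightarrow> nat" where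
  "min_degree V E = Min (vertex_degree E ` V)"

definition delta_star :: "nat \<Rightarrow> nat \<Rightarrow> vertex set set \<Rightarrow> nat" where
  "delta_star r n E =
     Min {min_degree (vclass n i \<union> vclass n j) (edges_between E (vclass n i) (vclass n j)) | i j.
            i < r \<and> j < r \<and> i \<noteq> j}"

definition partite_graphs :: "nat \<Rightarrow> real \<Rightarrow> nat \<Rightarrow> vertex set set set" where
  "partite_graphs r \<alpha> n =
     {E. E \<subseteq> cross_pairs r n \<and> real (delta_star r n E) \<ge> \<alpha> * real n}"

definition random_partite_graph :: "nat \<Rightarrow> nat \<Rightarrow> real \<Rightarrow> vertex set set pmf" where
  "random_partite_graph r n p =
     map_pmf (\<lambda>f. {e \<in> cross_pairs r n. f e})
       (Pi_pmf (cross_pairs r n) False (\<lambda>_. bernoulli_pmf p))"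

definition spans_complete :: "nat \<Rightarrow> 'a set set \<Rightarrow> 'a set \<Rightarrow> bool" where
  "spans_complete r E K \<longleftrightarrow> card K = r \<and> (\<forall>u\<in>K. \<forall>v\<in>K. u \<noteq> v \<longrightarrow> {u, v} \<in> E)"

text \<open>A copy of \<open>K\<^sub>r\<close> is identified with its vertex set.\<close>

definition has_perfect_tiling :: "nat \<Rightarrow> 'a set \<Rightarrow> 'a set set \<Rightarrow> bool" where
  "has_perfect_tiling r V E \<longleftrightarrow>
     (\<exists>T. (\<forall>K\<in>T. spans_complete r E K) \<and> disjoint T \<and> \<Union>T = V)"

definition whp :: "(nat \<Rightarrow> 'a pmf) \<Rightarrow> (nat \<Rightarrow> 'a \<Rightarrow> bool) \<Rightarrow> bool" where
  "whp M Q \<longleftrightarrow> (\<lambda>n. measure_pmf.prob (M n) {x. Q n x}) \<longlonglongrightarrow> 1"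

text \<open>The bounds on \<open>p\<close> are required for all sufficiently large \<open>n\<close> only: for small \<open>n\<close> the
  number \<open>C * t n\<close> may exceed \<open>1\<close>, so that a pointwise lower bound would be unsatisfiable.\<close>

definition threshold_function ::
    "nat \<Rightarrow> (nat \<Rightarrow> vertex set set set) \<Rightarrow> (nat \<Rightarrow> vertex set set \<Rightarrow> bool) \<Rightarrow> (nat \<Rightarrow> real) \<Rightarrow> bool" where
  "threshold_function r \<G> P t \<longleftrightarrow>
     (\<exists>c>0. \<exists>C>0.
        (\<forall>p. (\<forall>n. 0 \<le> p n \<and> p n \<le> 1) \<and> (\<forall>\<^sub>F n in sequentially. p n \<ge> C * t n) \<longrightarrow>
           (\<forall>G. (\<forall>n. G n \<in> \<G> n) \<longrightarrow>
              whp (\<lambda>n. random_partite_graph r n (p n)) (\<lambda>n H. P n (G n \<union> H)))) \<and>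
        (\<forall>p. (\<forall>n. 0 \<le> p n \<and> p n \<le> 1) \<and> (\<forall>\<^sub>F n in sequentially. p n \<le> c * t n) \<longrightarrow>
           (\<exists>G. (\<forall>n. G n \<in> \<G> n) \<and>
              whp (\<lambda>n. random_partite_graph r n (p n)) (\<lambda>n H. \<not> P n (G n \<union> H)))))"

end

theory Submission
  imports Defs
begin

text \<open>
  Above the threshold, Janson's inequality and a union bound show that whp the random graph \<open>H\<close> is
  \<open>clique_rich\<close>: any choice of linearly many vertices in each class contains a transversal clique
  of \<open>H\<close>. Hence a greedy choice gives a tiling by cliques of \<open>H\<close> that leaves over fewer than
  \<open>\<epsilon> n\<close> vertices of each class. As the distribution of \<open>H\<close> is invariant under permutations of the
  classes, this tiling may be assumed to be in random position relative to \<open>G\<close>, so for every vertex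
  \<open>x\<close>, a positive fraction of the tiles have all their vertices outside the class of \<open>x\<close>
  in the \<open>G\<close>-neighbourhood of \<open>x\<close>. In any of these tiles \<open>x\<close> may replace the vertex of its own
  class. Given one leftover vertex of each class, richness yields replacements for which the released
  vertices form a clique of \<open>H\<close>; iterating this, all leftover vertices are covered.

  Below the threshold, let \<open>G\<close> consist of all edges meeting a set \<open>A\<close> of \<open>\<alpha> n\<close> vertices of
  each class. A perfect tiling has at least \<open>(1 - r \<alpha>) n\<close> tiles that avoid \<open>A\<close> and are thus
  disjoint cliques of \<open>H\<close>; the first moment of the number of such families tends to \<open>0\<close>.
\<close>

section \<open>Random subsets of a finite set\<close>

definition random_subset :: "'a set \<Rightarrow> real \<Rightarrow> 'a set pmf" where
  "random_subset U p = map_pmf (\<lambda>f. {e \<in> U. f e}) (Pi_pmf U False (\<lambda>_. bernoulli_pmf p))"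

lemma prob_bind_pmf:
  "measure_pmf.prob (bind_pmf M N) X = (\<integral>x. measure_pmf.prob (N x) X \<partial>measure_pmf M)"
proof -
  have int: "integrable (measure_pmf M) (\<lambda>x. measure_pmf.prob (N x) X)"
    by (rule measure_pmf.integrable_const_bound[where B = 1]) auto
  have "ennreal (measure_pmf.prob (bind_pmf M N) X) = emeasure (bind_pmf M N) X"
    by (simp add: measure_pmf.emeasure_eq_measure)
  also have "\<dots> = (\<integral>\<^sup>+x. ennreal (measure_pmf.prob (N x) X) \<partial>measure_pmf M)"
    unfolding emeasure_bind_pmf by (simp add: measure_pmf.emeasure_eq_measure)
  also have "\<dots> = ennreal (\<integral>x. measure_pmf.prob (N x) X \<partial>measure_pmf M)"
    by (rule nn_integral_eq_integral[OF int]) auto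
  finally show ?thesis
    by (subst (asm) ennreal_inj) auto
qed

text \<open>Two-stage exposure: \<open>B\<close> collects the first-stage outcomes after which
  nothing is known, and \<open>q\<close> bounds the conditional failure probability
  otherwise.\<close>

lemma prob_bind_pmf_le:
  assumes "\<And>x. x \<in> set_pmf M \<Longrightarrow> x \<notin> B \<Longrightarrow> measure_pmf.prob (N x) X \<le> q" and "0 \<le> q"
  shows "measure_pmf.prob (bind_pmf M N) X \<le> measure_pmf.prob M B + q"
proof -
  have "measure_pmf.prob (bind_pmf M N) X \<le> (\<integral>x. indicator B x + q \<partial>measure_pmf M)"
    unfolding prob_bind_pmf
  proof (rule integral_mono_AE)
    show "integrable (measure_pmf M) (\<lambda>x. measure_pmf.prob (N x) X)"
      by (rule measure_pmf.integrable_const_bound[where B = 1]) auto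
    show "integrable (measure_pmf M) (\<lambda>x. indicator B x + q)"
      by (rule measure_pmf.integrable_const_bound[where B = "1 + q"])
         (auto simp: indicator_def assms(2))
    show "AE x in measure_pmf M. measure_pmf.prob (N x) X \<le> indicator B x + q"
      using assms by (auto simp: AE_measure_pmf_iff indicator_def intro: order_trans[OF measure_pmf.prob_le_1])
  qed
  also have "\<dots> = measure_pmf.prob M B + q"
    by (subst Bochner_Integration.integral_add)
       (auto intro: measure_pmf.integrable_const_bound[where B = 1])
  finally show ?thesis .
qed

lemma random_subset_insert:
  assumes "finite U" "e \<notin> U"
  shows "random_subset (insert e U) p =
    bind_pmf (bernoulli_pmf p) (\<lambda>b. map_pmf (\<lambda>H. if b then insert e H else H) (random_subset U p))"
proof -
  have *: "{x \<in> insert e U. (f(e := b)) x} = (if b then insert e {x \<in> U. f x} else {x \<in> U. f x})"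
    for f b using assms(2) by auto
  show ?thesis
    unfolding random_subset_def Pi_pmf_insert'[OF assms]
    unfolding map_bind_pmf map_pmf_comp map_return_pmf * map_pmf_def[symmetric] ..
qed

context
  fixes p :: real
  assumes p01: "0 \<le> p" "p \<le> 1"
begin

text \<open>Whether \<open>e\<close> lies in \<open>H\<close> is independent of the rest of
  \<open>H\<close>, and \<open>P (insert e H)\<close> depends on that rest only.\<close>

lemma prob_random_subset_mem:
  assumes "finite U" "e \<in> U"
  shows "measure_pmf.prob (random_subset U p) {H. e \<in> H \<and> P H} =
         p * measure_pmf.prob (random_subset U p) {H. P (insert e H)}"
proof -
  define W where "W = U - {e}"
  have W: "finite W" "e \<notin> W" "U = insert e W"
    using assms by (auto simp: W_def)
  have sub: "e \<notin> H" if "H \<in> set_pmf (random_subset W p)" for H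
    using that W by (auto simp: random_subset_def)
  define Q where "Q = measure_pmf.prob (random_subset W p) {H. P (insert e H)}"
  have "measure_pmf.prob (random_subset W p) {H. e \<in> H \<and> P H} = 0"
    using sub by (subst measure_pmf_zero_iff) auto
  then have "measure_pmf.prob (random_subset U p) {H. e \<in> H \<and> P H} = p * Q"
    unfolding W(3) random_subset_insert[OF W(1,2)] prob_bind_pmf
    using p01 by (simp add: vimage_def Q_def)
  moreover have "measure_pmf.prob (random_subset U p) {H. P (insert e H)} = Q"
    unfolding W(3) random_subset_insert[OF W(1,2)] prob_bind_pmf
    using p01 by (simp add: vimage_def Q_def algebra_simps)
  ultimately show ?thesis by simp
qed

text \<open>Conditioned on \<open>F \<subseteq> H\<close>, the random set is distributed as
  \<open>F \<union> H\<close>. This form stands in for conditional probabilities and stays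
  meaningful for \<open>p = 0\<close>.\<close>

lemma prob_random_subset_superset:
  assumes "finite U" "F \<subseteq> U"
  shows "measure_pmf.prob (random_subset U p) {H. F \<subseteq> H \<and> P H} =
         p ^ card F * measure_pmf.prob (random_subset U p) {H. P (F \<union> H)}"
proof -
  have "finite F" using assms finite_subset by blast
  then show ?thesis using assms(2)
  proof (induction F arbitrary: P rule: finite_induct)
    case empty
    then show ?case by simp
  next
    case (insert e F)
    have "measure_pmf.prob (random_subset U p) {H. insert e F \<subseteq> H \<and> P H} =
          measure_pmf.prob (random_subset U p) {H. e \<in> H \<and> (F \<subseteq> H \<and> P H)}"
      by (rule arg_cong[where f = "measure _"]) auto
    also have "\<dots> = p * measure_pmf.prob (random_subset U p) {H. F \<subseteq> insert e H \<and> P (insert e H)}"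
      using insert.prems assms(1) by (subst prob_random_subset_mem) auto
    also have "{H. F \<subseteq> insert e H \<and> P (insert e H)} = {H. F \<subseteq> H \<and> P (insert e H)}"
      using insert.hyps by auto
    also have "measure_pmf.prob (random_subset U p) \<dots> =
        p ^ card F * measure_pmf.prob (random_subset U p) {H. P (insert e (F \<union> H))}"
      using insert.prems by (subst insert.IH) auto
    finally show ?case using insert.hyps by simp
  qed
qed

lemma prob_random_subset_superset':
  assumes "finite U" "F \<subseteq> U"
  shows "measure_pmf.prob (random_subset U p) {H. F \<subseteq> H} = p ^ card F"
  using prob_random_subset_superset[OF assms, of "\<lambda>_. True"] by simp

text \<open>Janson's inequality. The correlation inequality needed in its proof only concerns an event
  \<open>F \<subseteq> H\<close> and a decreasing event, for which it is immediate from
  \<open>prob_random_subset_superset\<close>.\<close>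

lemma janson_step:
  fixes E :: "'i \<Rightarrow> 'a set"
  assumes U: "finite U" "\<And>j. j \<in> insert i I \<Longrightarrow> E j \<subseteq> U" and I: "finite I" "i \<notin> I"
  shows "measure_pmf.prob (random_subset U p) {H. \<forall>j\<in>insert i I. \<not> E j \<subseteq> H} \<le>
    measure_pmf.prob (random_subset U p) {H. \<forall>j\<in>I. \<not> E j \<subseteq> H} *
    exp (- (p ^ card (E i)) + (\<Sum>j | j \<in> I \<and> E j \<inter> E i \<noteq> {}. p ^ card (E i \<union> E j)))"
proof -
  let ?P = "\<lambda>Q. measure_pmf.prob (random_subset U p) {H. Q H}"
  \<comment> \<open>The indices in \<open>I\<close> are split into \<open>N\<close>, whose sets meet
    \<open>E i\<close>, and the rest. The event \<open>D\<close> that no set of the rest lies in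
    \<open>H\<close> is unaffected by adding \<open>E i\<close>, hence independent of
    \<open>E i \<subseteq> H\<close>.\<close>
  define N where "N = {j \<in> I. E j \<inter> E i \<noteq> {}}"
  define D where "D = (\<lambda>H. \<forall>j\<in>I - N. \<not> E j \<subseteq> H)"
  define S where "S = (\<Sum>j\<in>N. p ^ card (E i \<union> E j))"
  have finN: "finite N" using I by (auto simp: N_def)
  have D_insens: "D (E i \<union> H) \<longleftrightarrow> D H" for H
    unfolding D_def N_def by blast
  have D_dec: "D (F \<union> H) \<Longrightarrow> D H" for F H
    unfolding D_def by blast
  have 1: "?P (\<lambda>H. E i \<subseteq> H \<and> D H) = p ^ card (E i) * ?P D"
    using U by (subst prob_random_subset_superset) (auto simp: D_insens)
  have 2: "?P (\<lambda>H. E i \<union> E j \<subseteq> H \<and> D H) \<le> p ^ card (E i \<union> E j) * ?P D" if "j \<in> N" for j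
  proof -
    have "?P (\<lambda>H. E i \<union> E j \<subseteq> H \<and> D H) =
        p ^ card (E i \<union> E j) * ?P (\<lambda>H. D (E i \<union> E j \<union> H))"
      using U that by (intro prob_random_subset_superset) (auto simp: N_def)
    also have "\<dots> \<le> p ^ card (E i \<union> E j) * ?P D"
      using p01 by (intro mult_left_mono measure_pmf.finite_measure_mono) (auto dest: D_dec)
    finally show ?thesis .
  qed
  have sub: "{H. E i \<subseteq> H \<and> D H} \<subseteq> {H. E i \<subseteq> H \<and> (\<forall>j\<in>I. \<not> E j \<subseteq> H)} \<union>
      (\<Union>j\<in>N. {H. E i \<union> E j \<subseteq> H \<and> D H})"
    unfolding D_def by auto
  have "?P (\<lambda>H. E i \<subseteq> H \<and> D H) \<le> ?P (\<lambda>H. E i \<subseteq> H \<and> (\<forall>j\<in>I. \<not> E j \<subseteq> H)) +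
      measure_pmf.prob (random_subset U p) (\<Union>j\<in>N. {H. E i \<union> E j \<subseteq> H \<and> D H})"
    by (rule order_trans[OF measure_pmf.finite_measure_mono[OF sub]
          measure_Un_le]) auto
  also have "measure_pmf.prob (random_subset U p) (\<Union>j\<in>N. {H. E i \<union> E j \<subseteq> H \<and> D H}) \<le>
      (\<Sum>j\<in>N. ?P (\<lambda>H. E i \<union> E j \<subseteq> H \<and> D H))"
    using finN by (intro measure_pmf.finite_measure_subadditive_finite) auto
  also have "\<dots> \<le> (\<Sum>j\<in>N. p ^ card (E i \<union> E j) * ?P D)"
    by (intro sum_mono 2)
  finally have 3: "(p ^ card (E i) - S) * ?P D \<le> ?P (\<lambda>H. E i \<subseteq> H \<and> (\<forall>j\<in>I. \<not> E j \<subseteq> H))"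
    unfolding 1 S_def left_diff_distrib sum_distrib_right by linarith
  let ?Q = "?P (\<lambda>H. \<forall>j\<in>I. \<not> E j \<subseteq> H)"
  have QD: "?Q \<le> ?P D"
    by (intro measure_pmf.finite_measure_mono) (auto simp: D_def)
  have 4: "(p ^ card (E i) - S) * ?Q \<le> ?P (\<lambda>H. E i \<subseteq> H \<and> (\<forall>j\<in>I. \<not> E j \<subseteq> H))"
  \<comment> \<open>A negative factor would reverse \<open>?Q \<le> ?P D\<close>, but then the left
    side is nonpositive and the claim is trivial.\<close>
  proof (cases "p ^ card (E i) - S \<ge> 0")
    case True
    then show ?thesis using mult_left_mono[OF QD True] 3 by linarith
  next
    case False
    then have "(p ^ card (E i) - S) * ?Q \<le> 0"
      by (intro mult_nonpos_nonneg) auto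
    then show ?thesis using measure_nonneg[of "random_subset U p"] by (meson order_trans)
  qed
  have "?Q = ?P (\<lambda>H. \<forall>j\<in>insert i I. \<not> E j \<subseteq> H) + ?P (\<lambda>H. E i \<subseteq> H \<and> (\<forall>j\<in>I. \<not> E j \<subseteq> H))"
    by (subst measure_pmf.finite_measure_Union[symmetric])
       (auto intro!: arg_cong[where f = "measure _"])
  with 4 have "?P (\<lambda>H. \<forall>j\<in>insert i I. \<not> E j \<subseteq> H) \<le> ?Q * (1 + (- (p ^ card (E i)) + S))"
    by (simp add: algebra_simps)
  also have "\<dots> \<le> ?Q * exp (- (p ^ card (E i)) + S)"
    by (intro mult_left_mono exp_ge_add_one_self) auto
  finally show ?thesis unfolding S_def N_def .
qed

text \<open>The factors of \<open>janson_step\<close> are multiplied while the indices are added one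
  at a time. The double sum counts dependent pairs in both orders.\<close>

lemma janson_inequality:
  fixes E :: "'i \<Rightarrow> 'a set"
  assumes "finite U" "finite I" "\<And>i. i \<in> I \<Longrightarrow> E i \<subseteq> U"
  shows "measure_pmf.prob (random_subset U p) {H. \<forall>i\<in>I. \<not> E i \<subseteq> H} \<le>
    exp (- (\<Sum>i\<in>I. p ^ card (E i)) +
         (\<Sum>i\<in>I. \<Sum>j | j \<in> I \<and> j \<noteq> i \<and> E j \<inter> E i \<noteq> {}. p ^ card (E i \<union> E j)))"
  using assms(2,3)
proof (induction I rule: finite_induct)
  case empty
  then show ?case by simp
next
  case (insert i I)
  let ?D = "\<lambda>I i. \<Sum>j | j \<in> I \<and> j \<noteq> i \<and> E j \<inter> E i \<noteq> {}. p ^ card (E i \<union> E j)"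
  have "measure_pmf.prob (random_subset U p) {H. \<forall>j\<in>insert i I. \<not> E j \<subseteq> H} \<le>
    measure_pmf.prob (random_subset U p) {H. \<forall>j\<in>I. \<not> E j \<subseteq> H} *
    exp (- (p ^ card (E i)) + (\<Sum>j | j \<in> I \<and> E j \<inter> E i \<noteq> {}. p ^ card (E i \<union> E j)))"
    using insert assms(1) by (intro janson_step) auto
  also have "\<dots> \<le> exp (- (\<Sum>i\<in>I. p ^ card (E i)) + (\<Sum>i\<in>I. ?D I i)) *
    exp (- (p ^ card (E i)) + ?D (insert i I) i)"
  proof (intro mult_mono)
    have "{j \<in> I. E j \<inter> E i \<noteq> {}} = {j \<in> insert i I. j \<noteq> i \<and> E j \<inter> E i \<noteq> {}}"
      using insert.hyps by auto
    then show "exp (- (p ^ card (E i)) + (\<Sum>j | j \<in> I \<and> E j \<inter> E i \<noteq> {}. p ^ card (E i \<union> E j))) \<le>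
       exp (- (p ^ card (E i)) + ?D (insert i I) i)" by simp
  qed (use insert in auto)
  also have "\<dots> = exp (- (\<Sum>i\<in>insert i I. p ^ card (E i)) + ((\<Sum>i\<in>I. ?D I i) + ?D (insert i I) i))"
    using insert.hyps by (simp add: algebra_simps flip: exp_add)
  \<comment> \<open>The step only yields each pair once, with the newer index first; the reversed
    pairs are added to make the sum symmetric.\<close>
  also have "\<dots> \<le> exp (- (\<Sum>i\<in>insert i I. p ^ card (E i)) + (\<Sum>k\<in>insert i I. ?D (insert i I) k))"
  proof -
    have "(\<Sum>k\<in>I. ?D I k) \<le> (\<Sum>k\<in>I. ?D (insert i I) k)"
      using insert.hyps p01 by (intro sum_mono sum_mono2) auto
    then show ?thesis using insert.hyps by simp
  qed
  finally show ?case .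
qed

end

section \<open>Coupling and symmetry of random subsets\<close>

text \<open>Coupling: each element gets two independent coins of bias \<open>p\<close> and
  \<open>q / p\<close>. The first alone decides membership in the larger set, both together in the
  smaller one. The case \<open>p = 0\<close> is separate because of the quotient.\<close>

lemma prob_random_subset_mono:
  assumes "finite U" "0 \<le> q" "q \<le> p" "p \<le> 1"
    and mono: "\<And>H H'. P H \<Longrightarrow> H \<subseteq> H' \<Longrightarrow> P H'"
  shows "measure_pmf.prob (random_subset U q) {H. P H} \<le> measure_pmf.prob (random_subset U p) {H. P H}"
proof (cases "p = 0")
  case False
  define J where "J = pair_pmf (bernoulli_pmf p) (bernoulli_pmf (q / p))"
  have p: "bernoulli_pmf p = map_pmf fst J"
    by (simp add: J_def map_fst_pair_pmf)
  have q: "bernoulli_pmf q = map_pmf (\<lambda>x. fst x \<and> snd x) J"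
  proof -
    have "map_pmf (\<lambda>x. fst x \<and> snd x) J =
      bind_pmf (bernoulli_pmf p) (\<lambda>a. map_pmf (\<lambda>b. a \<and> b) (bernoulli_pmf (q / p)))"
      unfolding J_def pair_pmf_def by (simp add: map_bind_pmf map_pmf_def bind_return_pmf bind_assoc_pmf)
    moreover have "pmf \<dots> True = q"
    proof -
      have *: "Collect ((\<and>) True) = {True}" "Collect ((\<and>) False) = {}" by auto
      show ?thesis
        using assms False by (simp add: pmf_bind pmf_map vimage_def * measure_pmf_single)
    qed
    ultimately have "pmf (map_pmf (\<lambda>x. fst x \<and> snd x) J) True = pmf (bernoulli_pmf q) True"
      using assms by simp
    then show ?thesis
      by (intro pmf_eqI) (metis (full_types) pmf_False_conv_True)
  qed
  define K where "K = Pi_pmf U (False, False) (\<lambda>_. J)"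
  have "random_subset U q = map_pmf (\<lambda>f. {e \<in> U. fst (f e) \<and> snd (f e)}) K"
    unfolding random_subset_def q K_def
    by (subst Pi_pmf_map[where dflt = "(False, False)"]) (auto simp: assms map_pmf_comp)
  moreover have "random_subset U p = map_pmf (\<lambda>f. {e \<in> U. fst (f e)}) K"
    unfolding random_subset_def p K_def
    by (subst Pi_pmf_map[where dflt = "(False, False)"]) (auto simp: assms map_pmf_comp)
  ultimately show ?thesis
    by (auto intro!: measure_pmf.finite_measure_mono elim!: mono)
qed (use assms in auto)

lemma random_subset_image:
  assumes "finite U" "bij_betw h U U"
  shows "map_pmf ((`) h) (random_subset U p) = random_subset U p"
proof -
  \<comment> \<open>Outside \<open>U\<close> the map \<open>h\<close> may take values in
    \<open>U\<close>; \<open>g\<close> is the identity there, so that points outside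
    \<open>U\<close> stay outside when the product distribution is reindexed.\<close>
  define g where "g = (\<lambda>x. if x \<in> U then h x else x)"
  have bij: "bij_betw g U U"
    using assms(2) by (subst bij_betw_cong[of U g h]) (auto simp: g_def)
  have "random_subset U p = map_pmf ((`) h) (map_pmf (\<lambda>f. {e \<in> U. (f \<circ> g) e}) (Pi_pmf U False (\<lambda>_. bernoulli_pmf p)))"
    unfolding random_subset_def map_pmf_comp
  proof (intro map_pmf_cong refl)
    fix f
    show "{e \<in> U. f e} = h ` {e \<in> U. (f \<circ> g) e}"
      using assms(2) by (fastforce simp: g_def bij_betw_def)
  qed
  also have "map_pmf (\<lambda>f. {e \<in> U. (f \<circ> g) e}) (Pi_pmf U False (\<lambda>_. bernoulli_pmf p)) = random_subset U p"
    unfolding random_subset_def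
    using assms(1) bij by (subst (2) Pi_pmf_bij_betw[where h = g and B = U]) (auto simp: map_pmf_comp g_def)
  finally show ?thesis by simp
qed

section \<open>Transversal cliques\<close>

text \<open>A transversal clique is encoded by the function \<open>f\<close> picking the vertex
  \<open>(i, f i)\<close> of each class. As an image of the two-element index sets, its edge set can
  be counted by counting index sets.\<close>

definition tile_edges :: "nat \<Rightarrow> (nat \<Rightarrow> nat) \<Rightarrow> vertex set set" where
  "tile_edges r f = (\<lambda>e. (\<lambda>i. (i, f i)) ` e) ` {e. e \<subseteq> {..<r} \<and> card e = 2}"

lemma mem_tile_edges_iff:
  "e \<in> tile_edges r f \<longleftrightarrow> (\<exists>i<r. \<exists>j<r. i \<noteq> j \<and> e = {(i, f i), (j, f j)})"
proof
  assume "e \<in> tile_edges r f"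
  then obtain d where d: "d \<subseteq> {..<r}" "card d = 2" "e = (\<lambda>i. (i, f i)) ` d"
    by (auto simp: tile_edges_def)
  from d(2) obtain i j where "d = {i, j}" "i \<noteq> j"
    by (auto simp: card_2_iff)
  with d have "i < r" "j < r" "i \<noteq> j" "e = {(i, f i), (j, f j)}" by auto
  then show "\<exists>i<r. \<exists>j<r. i \<noteq> j \<and> e = {(i, f i), (j, f j)}" by blast
next
  assume "\<exists>i<r. \<exists>j<r. i \<noteq> j \<and> e = {(i, f i), (j, f j)}"
  then obtain i j where ij: "i < r" "j < r" "i \<noteq> j" "e = {(i, f i), (j, f j)}" by blast
  then have "e = (\<lambda>i. (i, f i)) ` {i, j}" "{i, j} \<subseteq> {..<r}" "card {i, j} = 2" by auto
  then show "e \<in> tile_edges r f" unfolding tile_edges_def by blast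
qed

lemma tile_edges_subset_iff:
  "tile_edges r f \<subseteq> E \<longleftrightarrow> (\<forall>i<r. \<forall>j<r. i \<noteq> j \<longrightarrow> {(i, f i), (j, f j)} \<in> E)"
  by (auto simp: mem_tile_edges_iff subset_iff)

lemma tile_edges_cong: "(\<And>i. i < r \<Longrightarrow> f i = g i) \<Longrightarrow> tile_edges r f = tile_edges r g"
  unfolding tile_edges_def by (intro image_cong refl) auto

lemma inj_on_graph_image: "inj_on (\<lambda>e. (\<lambda>i. (i, f i)) ` e) A"
proof -
  have "fst ` (\<lambda>i. (i, f i)) ` e = e" for e by (simp add: image_image)
  then show ?thesis by (metis inj_onI)
qed

lemma card_tile_edges: "card (tile_edges r f) = r choose 2"
  unfolding tile_edges_def
  by (subst card_image[OF inj_on_graph_image]) (simp add: n_subsets)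

lemma finite_tile_edges: "finite (tile_edges r f)"
  by (auto simp: tile_edges_def intro: finite_subset[of _ "Pow {..<r}"])

text \<open>Vertices carry their class, so a common edge must join two classes in which
  \<open>f\<close> and \<open>g\<close> agree.\<close>

lemma card_tile_edges_Int:
  "card (tile_edges r f \<inter> tile_edges r g) = card {i. i < r \<and> f i = g i} choose 2"
proof -
  let ?K = "{i. i < r \<and> f i = g i}"
  have "tile_edges r f \<inter> tile_edges r g = (\<lambda>e. (\<lambda>i. (i, f i)) ` e) ` {e. e \<subseteq> ?K \<and> card e = 2}"
    (is "?L = ?R")
  proof
    show "?L \<subseteq> ?R"
    proof
      fix e assume e: "e \<in> ?L"
      then obtain i j where ij: "i < r" "j < r" "i \<noteq> j" "e = {(i, f i), (j, f j)}"
        by (auto simp: mem_tile_edges_iff)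
      from e obtain i' j' where ij': "e = {(i', g i'), (j', g j')}"
        by (auto simp: mem_tile_edges_iff)
      from ij ij' have "f i = g i" "f j = g j" by (auto simp: doubleton_eq_iff)
      with ij have "e = (\<lambda>i. (i, f i)) ` {i, j}" "{i, j} \<subseteq> ?K" "card {i, j} = 2" by auto
      then show "e \<in> ?R" by blast
    qed
    show "?R \<subseteq> ?L"
    proof
      fix e assume "e \<in> ?R"
      then obtain d where d: "d \<subseteq> ?K" "card d = 2" "e = (\<lambda>i. (i, f i)) ` d" by blast
      moreover have "(\<lambda>i. (i, f i)) ` d = (\<lambda>i. (i, g i)) ` d"
        using d(1) by (intro image_cong) auto
      moreover have "d \<subseteq> {..<r}" using d(1) by auto
      ultimately show "e \<in> ?L" unfolding tile_edges_def by blast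
    qed
  qed
  then show ?thesis
    by (simp add: card_image[OF inj_on_graph_image] n_subsets)
qed

lemma finite_verts: "finite (verts r n)"
  by (auto simp: verts_def vclass_def)

lemma mem_cross_pairs_iff:
  "e \<in> cross_pairs r n \<longleftrightarrow>
     (\<exists>i<r. \<exists>j<r. \<exists>x<n. \<exists>y<n. i \<noteq> j \<and> e = {(i, x), (j, y)})"
  by (auto simp: cross_pairs_def vclass_def; blast)

lemma finite_cross_pairs: "finite (cross_pairs r n)"
  by (rule finite_subset[of _ "Pow (verts r n)"])
     (auto simp: mem_cross_pairs_iff verts_def vclass_def)

lemma tile_edges_subset_cross_pairs:
  assumes "\<And>i. i < r \<Longrightarrow> f i < n"
  shows "tile_edges r f \<subseteq> cross_pairs r n"
  unfolding tile_edges_subset_iff mem_cross_pairs_iff using assms by blast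

lemma random_partite_graph_eq: "random_partite_graph r n p = random_subset (cross_pairs r n) p"
  by (simp add: random_partite_graph_def random_subset_def)

section \<open>Richness in transversal cliques by Janson's inequality\<close>

definition clique_rich :: "nat \<Rightarrow> nat \<Rightarrow> nat \<Rightarrow> vertex set set \<Rightarrow> bool" where
  "clique_rich r n s H \<longleftrightarrow>
     (\<forall>S. (\<forall>i<r. S i \<subseteq> {..<n} \<and> s \<le> card (S i)) \<longrightarrow>
       (\<exists>f. (\<forall>i<r. f i \<in> S i) \<and> tile_edges r f \<subseteq> H))"

lemma clique_richD:
  assumes "clique_rich r n s H" "\<And>i. i < r \<Longrightarrow> S i \<subseteq> {..<n}" "\<And>i. i < r \<Longrightarrow> s \<le> card (S i)"
  obtains f where "\<And>i. i < r \<Longrightarrow> f i \<in> S i" "tile_edges r f \<subseteq> H"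
proof -
  have "\<exists>f. (\<forall>i<r. f i \<in> S i) \<and> tile_edges r f \<subseteq> H"
    using assms unfolding clique_rich_def by simp
  then show thesis using that by blast
qed

lemma clique_rich_mono:
  assumes "clique_rich r n s H" "H \<subseteq> H'"
  shows "clique_rich r n s H'"
  unfolding clique_rich_def
proof (intro allI impI)
  fix S assume S: "\<forall>i<r. S i \<subseteq> {..<n} \<and> s \<le> card (S i)"
  obtain f where "\<And>i. i < r \<Longrightarrow> f i \<in> S i" "tile_edges r f \<subseteq> H"
    by (rule clique_richD[OF assms(1), of S]) (use S in auto)
  with assms(2) show "\<exists>f. (\<forall>i<r. f i \<in> S i) \<and> tile_edges r f \<subseteq> H'" by blast
qed

text \<open>Bounds the conditional expectation, given a transversal clique, of the number of other ones
  that share an edge with it; \<open>K\<close> is the set of classes in which the two cliques agree.\<close>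

definition clique_correlation :: "nat \<Rightarrow> nat \<Rightarrow> real \<Rightarrow> real" where
  "clique_correlation r n p =
     (\<Sum>K | K \<subseteq> {..<r} \<and> 2 \<le> card K \<and> card K < r.
        real n ^ (r - card K) * p ^ ((r choose 2) - (card K choose 2)))"

lemma choose_two_mono: "m \<le> n \<Longrightarrow> m choose 2 \<le> n choose (2::nat)"
  by (simp add: binomial_right_mono)

text \<open>The cliques \<open>g\<close> are grouped by the set \<open>K\<close> of classes where
  they agree with \<open>f\<close>. A shared edge forces \<open>card K \<ge> 2\<close>, and
  \<open>g \<noteq> f\<close> forces \<open>card K < r\<close>. Fixing \<open>K\<close> leaves at
  most \<open>n ^ (r - card K)\<close> choices, and the union loses only the
  \<open>card K choose 2\<close> common edges.\<close>

lemma sum_overlapping_cliques_le: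
  assumes p: "0 \<le> p" and S: "\<And>i. i < r \<Longrightarrow> S i \<subseteq> {..<n}" and f: "f \<in> PiE {..<r} S"
  shows "(\<Sum>g | g \<in> PiE {..<r} S \<and> g \<noteq> f \<and> tile_edges r g \<inter> tile_edges r f \<noteq> {}.
            p ^ card (tile_edges r f \<union> tile_edges r g)) \<le>
         p ^ (r choose 2) * clique_correlation r n p"
proof -
  define agree where "agree = (\<lambda>g. {i. i < r \<and> f i = g i})"
  let ?I = "{g \<in> PiE {..<r} S. g \<noteq> f \<and> tile_edges r g \<inter> tile_edges r f \<noteq> {}}"
  let ?\<K> = "{K. K \<subseteq> {..<r} \<and> 2 \<le> card K \<and> card K < r}"
  have finS: "finite (S i)" if "i < r" for i using S[OF that] finite_subset by blast
  have finPi: "finite (PiE {..<r} S)" using finS by (intro finite_PiE) auto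
  have fin\<K>: "finite ?\<K>" by (rule finite_subset[of _ "Pow {..<r}"]) auto
  have agree: "agree g \<in> ?\<K>" if g: "g \<in> ?I" for g
  proof -
    have "card (agree g) < card {..<r}"
    proof (rule psubset_card_mono)
      have "agree g \<noteq> {..<r}"
      proof
        assume *: "agree g = {..<r}"
        have "g = f"
        proof (rule PiE_ext)
          show "g \<in> PiE {..<r} S" "f \<in> PiE {..<r} S" using g f by auto
          show "g i = f i" if "i \<in> {..<r}" for i
            using that unfolding *[symmetric] by (simp add: agree_def)
        qed
        then show False using g by simp
      qed
      then show "agree g \<subset> {..<r}" by (auto simp: agree_def)
    qed simp
    moreover have "tile_edges r f \<inter> tile_edges r g \<noteq> {}" using g by auto
    then have "card (tile_edges r f \<inter> tile_edges r g) \<noteq> 0"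
      using finite_tile_edges by simp
    then have "2 \<le> card (agree g)"
      unfolding card_tile_edges_Int agree_def by (metis binomial_eq_0 not_le)
    ultimately show ?thesis by (auto simp: agree_def)
  qed
  have card_union: "card (tile_edges r f \<union> tile_edges r g) =
      (r choose 2) + ((r choose 2) - (card (agree g) choose 2))" if "g \<in> ?I" for g
  proof -
    have "card (agree g) choose 2 \<le> r choose 2"
      using agree[OF that] by (intro choose_two_mono) auto
    then show ?thesis
      using card_Un_Int[OF finite_tile_edges finite_tile_edges, of r f r g]
      by (simp add: card_tile_edges card_tile_edges_Int agree_def)
  qed
  have fiber: "card {g \<in> ?I. agree g = K} \<le> n ^ (r - card K)" if K: "K \<in> ?\<K>" for K
  proof -
    have "{g \<in> ?I. agree g = K} \<subseteq> PiE {..<r} (\<lambda>i. if i \<in> K then {f i} else S i)"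
      by (auto simp: PiE_iff agree_def extensional_def split: if_splits)
    then have "card {g \<in> ?I. agree g = K} \<le> card (PiE {..<r} (\<lambda>i. if i \<in> K then {f i} else S i))"
      using finS by (intro card_mono finite_PiE) auto
    also have "\<dots> = (\<Prod>i<r. if i \<in> K then 1 else card (S i))"
      by (subst card_PiE) (auto intro!: prod.cong)
    also have "\<dots> = (\<Prod>i\<in>{..<r} - K. card (S i))"
      by (rule prod.mono_neutral_cong_right) auto
    also have "\<dots> \<le> (\<Prod>i\<in>{..<r} - K. n)"
    proof (intro prod_mono conjI)
      show "card (S i) \<le> n" if "i \<in> {..<r} - K" for i
        using that card_mono[OF _ S, of i] by simp
    qed simp
    also have "\<dots> = n ^ (r - card K)"
      using K finite_subset[of K "{..<r}"] by (simp add: card_Diff_subset)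
    finally show ?thesis .
  qed
  have "(\<Sum>g\<in>?I. p ^ card (tile_edges r f \<union> tile_edges r g)) =
      (\<Sum>K\<in>?\<K>. \<Sum>g | g \<in> ?I \<and> agree g = K. p ^ card (tile_edges r f \<union> tile_edges r g))"
    using finPi fin\<K> agree by (intro sum.group[symmetric]) auto
  also have "\<dots> = (\<Sum>K\<in>?\<K>. real (card {g \<in> ?I. agree g = K}) *
      (p ^ (r choose 2) * p ^ ((r choose 2) - (card K choose 2))))"
  proof (intro sum.cong refl)
    fix K assume "K \<in> ?\<K>"
    have "(\<Sum>g | g \<in> ?I \<and> agree g = K. p ^ card (tile_edges r f \<union> tile_edges r g)) =
      (\<Sum>g | g \<in> ?I \<and> agree g = K. p ^ (r choose 2) * p ^ ((r choose 2) - (card K choose 2)))"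
      using card_union by (intro sum.cong refl) (auto simp: power_add)
    then show "(\<Sum>g | g \<in> ?I \<and> agree g = K. p ^ card (tile_edges r f \<union> tile_edges r g)) =
      real (card {g \<in> ?I. agree g = K}) *
      (p ^ (r choose 2) * p ^ ((r choose 2) - (card K choose 2)))" by simp
  qed
  also have "\<dots> \<le> (\<Sum>K\<in>?\<K>. real (n ^ (r - card K)) *
      (p ^ (r choose 2) * p ^ ((r choose 2) - (card K choose 2))))"
    using p fiber by (intro sum_mono mult_right_mono) (simp_all only: of_nat_le_iff, simp)
  also have "\<dots> = p ^ (r choose 2) * clique_correlation r n p"
    unfolding clique_correlation_def sum_distrib_left by (intro sum.cong) auto
  finally show ?thesis .
qed

text \<open>In Janson's inequality the expectation is at least
  \<open>s ^ r * p ^ (r choose 2)\<close>, and the assumption \<open>corr\<close> makes the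
  dependency term at most half of the expectation.\<close>

lemma prob_no_transversal_clique_le:
  assumes p: "0 \<le> p" "p \<le> 1" and S: "\<And>i. i < r \<Longrightarrow> S i \<subseteq> {..<n} \<and> s \<le> card (S i)"
    and corr: "clique_correlation r n p \<le> 1 / 2"
  shows "measure_pmf.prob (random_partite_graph r n p) {H. \<forall>f\<in>PiE {..<r} S. \<not> tile_edges r f \<subseteq> H}
    \<le> exp (- (real s ^ r * p ^ (r choose 2) / 2))"
proof -
  let ?I = "PiE {..<r} S" and ?t = "r choose 2"
  have finI: "finite ?I" using S by (intro finite_PiE) (auto intro: finite_subset)
  have "s ^ r \<le> (\<Prod>i<r. card (S i))"
    using prod_mono[of "{..<r}" "\<lambda>_. s" "\<lambda>i. card (S i)"] S by simp
  then have cardI: "real s ^ r \<le> real (card ?I)"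
    by (simp add: card_PiE flip: of_nat_power of_nat_prod)
  have "measure_pmf.prob (random_partite_graph r n p) {H. \<forall>f\<in>?I. \<not> tile_edges r f \<subseteq> H} \<le>
    exp (- (\<Sum>f\<in>?I. p ^ card (tile_edges r f)) +
      (\<Sum>f\<in>?I. \<Sum>g | g \<in> ?I \<and> g \<noteq> f \<and> tile_edges r g \<inter> tile_edges r f \<noteq> {}.
         p ^ card (tile_edges r f \<union> tile_edges r g)))"
    unfolding random_partite_graph_eq
  proof (rule janson_inequality[OF p finite_cross_pairs finI])
    fix f assume "f \<in> ?I"
    then have "f i < n" if "i < r" for i
      using S[OF that] that by (auto simp: PiE_iff)
    then show "tile_edges r f \<subseteq> cross_pairs r n" by (rule tile_edges_subset_cross_pairs)
  qed
  also have "\<dots> \<le> exp (- (\<Sum>f\<in>?I. p ^ ?t) + (\<Sum>f\<in>?I. p ^ ?t * (1 / 2)))"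
  proof -
    have "(\<Sum>g | g \<in> ?I \<and> g \<noteq> f \<and> tile_edges r g \<inter> tile_edges r f \<noteq> {}.
         p ^ card (tile_edges r f \<union> tile_edges r g)) \<le> p ^ ?t * (1 / 2)" if "f \<in> ?I" for f
      using p S that mult_left_mono[OF corr, of "p ^ ?t"]
      by (intro order_trans[OF sum_overlapping_cliques_le]) auto
    then show ?thesis unfolding card_tile_edges exp_le_cancel_iff
      by (intro add_left_mono sum_mono)
  qed
  also have "\<dots> = exp (- (real (card ?I) * p ^ ?t / 2))" by simp
  also have "\<dots> \<le> exp (- (real s ^ r * p ^ ?t / 2))"
    using cardI p by (auto intro: mult_right_mono)
  finally show ?thesis .
qed

text \<open>Union bound over the at most \<open>(2 ^ n) ^ r\<close> families of vertex sets, one set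
  in each class.\<close>

lemma prob_not_clique_rich_le:
  assumes p: "0 \<le> p" "p \<le> 1" and corr: "clique_correlation r n p \<le> 1 / 2"
  shows "measure_pmf.prob (random_partite_graph r n p) {H. \<not> clique_rich r n s H} \<le>
    (2 ^ n) ^ r * exp (- (real s ^ r * p ^ (r choose 2) / 2))"
proof -
  let ?\<S> = "{S \<in> PiE {..<r} (\<lambda>_. Pow {..<n}). \<forall>i<r. s \<le> card (S i)}"
  let ?B = "\<lambda>S. {H. \<forall>f\<in>PiE {..<r} S. \<not> tile_edges r f \<subseteq> H}"
  have fin: "finite (PiE {..<r} (\<lambda>_. Pow {..<n}))" by (intro finite_PiE) auto
  have "{H. \<not> clique_rich r n s H} \<subseteq> (\<Union>S\<in>?\<S>. ?B S)"
  proof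
    fix H assume "H \<in> {H. \<not> clique_rich r n s H}"
    then obtain S where S: "\<And>i. i < r \<Longrightarrow> S i \<subseteq> {..<n} \<and> s \<le> card (S i)"
      and no: "\<And>f. (\<forall>i<r. f i \<in> S i) \<Longrightarrow> \<not> tile_edges r f \<subseteq> H"
      unfolding clique_rich_def mem_Collect_eq by blast
    have "restrict S {..<r} \<in> ?\<S>" using S by auto
    moreover have "H \<in> ?B (restrict S {..<r})" using no by (auto simp: PiE_iff)
    ultimately show "H \<in> (\<Union>S\<in>?\<S>. ?B S)" by blast
  qed
  then have "measure_pmf.prob (random_partite_graph r n p) {H. \<not> clique_rich r n s H} \<le>
      measure_pmf.prob (random_partite_graph r n p) (\<Union>S\<in>?\<S>. ?B S)"
    by (intro measure_pmf.finite_measure_mono) auto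
  also have "\<dots> \<le> (\<Sum>S\<in>?\<S>. measure_pmf.prob (random_partite_graph r n p) (?B S))"
    using fin by (intro measure_pmf.finite_measure_subadditive_finite) auto
  also have "\<dots> \<le> (\<Sum>S\<in>?\<S>. exp (- (real s ^ r * p ^ (r choose 2) / 2)))"
    using p corr by (intro sum_mono prob_no_transversal_clique_le) (auto simp: PiE_iff)
  also have "\<dots> = real (card ?\<S>) * exp (- (real s ^ r * p ^ (r choose 2) / 2))"
    by simp
  also have "\<dots> \<le> (2 ^ n) ^ r * exp (- (real s ^ r * p ^ (r choose 2) / 2))"
  proof -
    have "card ?\<S> \<le> card (PiE {..<r} (\<lambda>_. Pow {..<n}))" using fin by (intro card_mono) auto
    also have "\<dots> = (2 ^ n) ^ r" by (simp add: card_PiE card_Pow)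
    finally have "real (card ?\<S>) \<le> real ((2 ^ n) ^ r)" by (simp only: of_nat_le_iff)
    then show ?thesis by (intro mult_right_mono) auto
  qed
  finally show ?thesis .
qed

section \<open>Asymptotics at the threshold scale\<close>

lemma real_choose_two: "real (k choose 2) = real k * (real k - 1) / 2"
proof (induction k)
  case (Suc k)
  have "Suc k choose 2 = k + (k choose 2)" by (simp add: numeral_2_eq_2)
  then show ?case using Suc by (simp add: field_simps)
qed simp

text \<open>With \<open>k = card K\<close>, the power of \<open>n\<close> in the term of
  \<open>K\<close> is \<open>- (k - 1) * (r - k) / r\<close>, which is negative for
  \<open>2 \<le> k < r\<close>. Thus proper subcliques are abundant at this scale and correlations
  are negligible.\<close>

lemma clique_correlation_tendsto_0:
  assumes "C > 0"
  shows "(\<lambda>n. clique_correlation r n (C * real n powr (- 2 / real r))) \<longlonglongrightarrow> 0"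
  unfolding clique_correlation_def
proof (rule tendsto_null_sum)
  fix K assume "K \<in> {K. K \<subseteq> {..<r} \<and> 2 \<le> card K \<and> card K < r}"
  then have k: "2 \<le> card K" "card K < r" by auto
  define k where "k = card K"
  define u where "u = (r choose 2) - (k choose 2)"
  have u: "real u = (real r * (real r - 1) - real k * (real k - 1)) / 2"
    using k choose_two_mono[of k r] by (simp add: u_def k_def of_nat_diff real_choose_two field_simps)
  have expo: "real (r - k) + (- 2 / real r) * real u = - ((real k - 1) * (real r - real k) / real r)"
    using k unfolding u by (simp add: k_def of_nat_diff field_simps)
  have "(\<lambda>n. C ^ u * real n powr (- ((real k - 1) * (real r - real k) / real r))) \<longlonglongrightarrow> C ^ u * 0"
  proof (intro tendsto_intros tendsto_neg_powr)
    show "- ((real k - 1) * (real r - real k) / real r) < 0"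
      using k by (simp add: k_def divide_simps)
  qed (rule filterlim_real_sequentially)
  moreover have "\<forall>\<^sub>F n in sequentially. C ^ u * real n powr (- ((real k - 1) * (real r - real k) / real r)) =
     real n ^ (r - k) * (C * real n powr (- 2 / real r)) ^ u"
    using eventually_gt_at_top[of 0]
  proof eventually_elim
    case (elim n)
    have "real n ^ (r - k) * (C * real n powr (- 2 / real r)) ^ u =
        C ^ u * (real n powr real (r - k) * real n powr ((- 2 / real r) * real u))"
      using elim by (simp add: power_mult_distrib powr_realpow powr_power mult.commute)
    also have "\<dots> = C ^ u * real n powr (- ((real k - 1) * (real r - real k) / real r))"
      unfolding powr_add[symmetric] expo ..
    finally show ?case by simp
  qed
  ultimately show "(\<lambda>n. real n ^ (r - card K) * (C * real n powr (- 2 / real r)) ^ ((r choose 2) - (card K choose 2))) \<longlonglongrightarrow> 0"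
    unfolding k_def u_def by (simp add: tendsto_cong)
qed

text \<open>Up to a constant, the threshold makes the expected number of transversal cliques linear
  in \<open>n\<close>, which is the order of the number of tiles needed:
  \<open>(2 / r) * (r choose 2) = r - 1\<close>.\<close>

lemma power_choose_two_scaling:
  assumes "n > 0" "r > 0"
  shows "real n ^ r * (C * real n powr (- 2 / real r)) ^ (r choose 2) = C ^ (r choose 2) * real n"
proof -
  have "(real n powr (- 2 / real r)) ^ (r choose 2) = real n powr (1 - real r)"
  proof -
    have "(- 2 / real r) * real (r choose 2) = 1 - real r"
      using assms by (simp add: real_choose_two field_simps)
    then show ?thesis using assms by (simp only: powr_power mult.commute)
  qed
  then have "real n ^ r * (C * real n powr (- 2 / real r)) ^ (r choose 2) =
      C ^ (r choose 2) * (real n powr real r * real n powr (1 - real r))"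
    using assms by (simp add: power_mult_distrib powr_realpow)
  also have "real n powr real r * real n powr (1 - real r) = real n"
    using assms by (simp flip: powr_add)
  finally show ?thesis .
qed

text \<open>The union bound costs at most \<open>exp (r * n)\<close>, while the assumption on
  \<open>C\<close> makes Janson's bound at most \<open>exp (- (r + 1) * n)\<close>.\<close>

lemma clique_rich_whp:
  assumes r: "r > 0" and "\<epsilon> > 0" "C > 0" and C: "\<epsilon> ^ r * C ^ (r choose 2) / 2 \<ge> real r + 1"
    and p01: "\<And>n. 0 \<le> p n \<and> p n \<le> 1"
    and p: "\<forall>\<^sub>F n in sequentially. p n \<ge> C * real n powr (- 2 / real r)"
  shows "(\<lambda>n. measure_pmf.prob (random_partite_graph r n (p n))
           {H. \<not> clique_rich r n (nat \<lceil>\<epsilon> * real n\<rceil>) H}) \<longlonglongrightarrow> 0"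
proof (rule tendsto_sandwich[OF _ _ tendsto_const])
  let ?s = "\<lambda>n. nat \<lceil>\<epsilon> * real n\<rceil>"
  show "\<forall>\<^sub>F n in sequentially. 0 \<le> measure_pmf.prob (random_partite_graph r n (p n))
      {H. \<not> clique_rich r n (?s n) H}" by simp
  show "(\<lambda>n. exp (- real n)) \<longlonglongrightarrow> 0"
    by (rule filterlim_compose[OF exp_at_bot]) (auto intro!: filterlim_real_sequentially simp: filterlim_uminus_at_bot)
  have "\<forall>\<^sub>F n in sequentially. clique_correlation r n (C * real n powr (- 2 / real r)) < 1 / 2"
    by (rule order_tendstoD[OF clique_correlation_tendsto_0[OF \<open>C > 0\<close>]]) simp
  then show "\<forall>\<^sub>F n in sequentially. measure_pmf.prob (random_partite_graph r n (p n))
      {H. \<not> clique_rich r n (?s n) H} \<le> exp (- real n)"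
    using p eventually_gt_at_top[of 0]
  proof eventually_elim
    case (elim n)
    \<comment> \<open>\<open>clique_correlation\<close> is controlled only at the scale of
      \<open>q\<close>, so \<open>p n\<close> is first lowered to \<open>q\<close>; richness is
      monotone, so this can only increase the failure probability.\<close>
    define q where "q = C * real n powr (- 2 / real r)"
    have q: "0 \<le> q" "q \<le> p n" "q \<le> 1" using elim(2) p01[of n] \<open>C > 0\<close> by (auto simp: q_def)
    have "measure_pmf.prob (random_partite_graph r n (p n)) {H. \<not> clique_rich r n (?s n) H} =
        1 - measure_pmf.prob (random_partite_graph r n (p n)) {H. clique_rich r n (?s n) H}"
      by (subst measure_pmf.prob_compl[symmetric]) (auto intro!: arg_cong[where f = "measure _"])
    also have "\<dots> \<le> 1 - measure_pmf.prob (random_partite_graph r n q) {H. clique_rich r n (?s n) H}"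
      using q p01[of n] clique_rich_mono unfolding random_partite_graph_eq
      by (intro diff_left_mono prob_random_subset_mono finite_cross_pairs) auto
    also have "\<dots> = measure_pmf.prob (random_partite_graph r n q) {H. \<not> clique_rich r n (?s n) H}"
      by (subst measure_pmf.prob_compl[symmetric]) (auto intro!: arg_cong[where f = "measure _"])
    also have "\<dots> \<le> (2 ^ n) ^ r * exp (- (real (?s n) ^ r * q ^ (r choose 2) / 2))"
      using q elim(1) by (intro prob_not_clique_rich_le) (auto simp: q_def)
    also have "\<dots> \<le> exp (real r * real n) * exp (- ((real r + 1) * real n))"
    proof (intro mult_mono)
      have "(2::real) \<le> exp 1" using exp_ge_add_one_self[of 1] by simp
      then have "(2 ^ n) ^ r \<le> (exp 1 ^ n :: real) ^ r" by (intro power_mono) auto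
      also have "\<dots> = exp (real r * real n)"
        by (simp add: mult.commute flip: exp_of_nat_mult power_mult)
      finally show "(2 ^ n) ^ r \<le> exp (real r * real n)" .
      have "(real r + 1) * real n \<le> \<epsilon> ^ r * C ^ (r choose 2) / 2 * real n"
        using C by (intro mult_right_mono) auto
      also have "\<dots> = (\<epsilon> * real n) ^ r * q ^ (r choose 2) / 2"
        using power_choose_two_scaling[OF elim(3) r, of C]
        unfolding q_def power_mult_distrib[of \<epsilon>] by (simp only: mult.assoc times_divide_eq_right mult_ac)
      also have "\<dots> \<le> real (?s n) ^ r * q ^ (r choose 2) / 2"
        using q \<open>\<epsilon> > 0\<close> by (intro divide_right_mono mult_right_mono power_mono) auto
      finally show "exp (- (real (?s n) ^ r * q ^ (r choose 2) / 2)) \<le> exp (- ((real r + 1) * real n))"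
        by simp
    qed auto
    also have "\<dots> = exp (- real n)" by (simp add: algebra_simps flip: exp_add)
    finally show ?case .
  qed
qed

section \<open>Random permutations\<close>

text \<open>An unnormalised exponential moment: the number of points of \<open>A\<close> sent into
  \<open>B\<close> by a random permutation is hypergeometric, and the expectation of
  \<open>1/2\<close> to that power is bounded as for independent hits of probability
  \<open>\<beta>\<close>. The points of \<open>A\<close> are added one at a time.\<close>

lemma sum_permutations_half_power_hits_le:
  fixes \<beta> :: real
  assumes S: "finite S" "B \<subseteq> S" and A: "A \<subseteq> S" "\<beta> * real (card S) \<le> real (card B) - real (card A)"
    and "0 \<le> \<beta>"
  shows "(\<Sum>\<sigma> | \<sigma> permutes S. (1 / 2) ^ card {x \<in> A. \<sigma> x \<in> B}) \<le>
         fact (card S) * (1 - \<beta> / 2) ^ card A"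
proof -
  have finB: "finite B" using S finite_subset by blast
  have "finite A" using A S finite_subset by blast
  then show ?thesis using A
  proof (induction A rule: finite_induct)
    case empty
    then show ?case using S by (simp add: card_permutations)
  next
    case (insert x A)
    let ?\<Pi> = "{\<sigma>. \<sigma> permutes S}"
    let ?h = "\<lambda>A \<sigma>. card {x \<in> A. \<sigma> x \<in> B}"
    define Z where "Z = (\<lambda>A. \<Sum>\<sigma>\<in>?\<Pi>. (1 / 2 :: real) ^ ?h A \<sigma>)"
    have finP: "finite ?\<Pi>" using S(1) by (rule finite_permutations)
    have AS: "A \<subseteq> S" "x \<in> S" "card A < card S"
      using insert.prems insert.hyps S by (auto intro!: psubset_card_mono)
    have cardSA: "real (card (S - A)) = real (card S) - real (card A)"
      using AS insert.hyps S by (simp add: card_Diff_subset of_nat_diff card_mono)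
    \<comment> \<open>Precomposing with the transposition of \<open>x\<close> and \<open>y\<close> averages the image of \<open>x\<close>
      over \<open>S - A\<close> without affecting the images of \<open>A\<close>.\<close>
    have swap: "Z (insert x A) = (\<Sum>\<sigma>\<in>?\<Pi>. (1 / 2) ^ ?h A \<sigma> * (if \<sigma> y \<in> B then 1 / 2 else 1))"
      if y: "y \<in> S - A" for y
    proof -
      let ?T = "Transposition.transpose x y"
      have T: "?T permutes S" using AS y by (intro permutes_swap_id) auto
      have "Z (insert x A) = (\<Sum>\<sigma>\<in>?\<Pi>. (1 / 2) ^ ?h (insert x A) (\<sigma> \<circ> ?T))"
        unfolding Z_def
      proof (rule sum.reindex_bij_witness[where i = "\<lambda>\<sigma>. \<sigma> \<circ> ?T" and j = "\<lambda>\<sigma>. \<sigma> \<circ> ?T"])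
        fix \<sigma> assume "\<sigma> \<in> ?\<Pi>"
        then show "\<sigma> \<circ> ?T \<in> ?\<Pi>" using permutes_compose[OF T] by simp
        then show "\<sigma> \<circ> ?T \<in> ?\<Pi>" .
        show "\<sigma> \<circ> ?T \<circ> ?T = \<sigma>" by (simp add: o_assoc[symmetric])
        then show "\<sigma> \<circ> ?T \<circ> ?T = \<sigma>" .
        then show "(1 / 2) ^ ?h (insert x A) (\<sigma> \<circ> ?T \<circ> ?T) = (1 / 2) ^ ?h (insert x A) \<sigma>"
          by simp
      qed
      also have "\<dots> = (\<Sum>\<sigma>\<in>?\<Pi>. (1 / 2) ^ ?h A \<sigma> * (if \<sigma> y \<in> B then 1 / 2 else 1))"
      proof (intro sum.cong refl)
        fix \<sigma>
        have "{z \<in> insert x A. (\<sigma> \<circ> ?T) z \<in> B} =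
            (if \<sigma> y \<in> B then insert x {z \<in> A. \<sigma> z \<in> B} else {z \<in> A. \<sigma> z \<in> B})"
          using y insert.hyps by (auto simp: Transposition.transpose_def)
        then show "(1 / 2) ^ ?h (insert x A) (\<sigma> \<circ> ?T) = (1 / 2) ^ ?h A \<sigma> * (if \<sigma> y \<in> B then 1 / 2 else (1::real))"
          using insert.hyps by (simp add: card_insert_if)
      qed
      finally show ?thesis .
    qed
    have "real (card (S - A)) * Z (insert x A) = (\<Sum>y\<in>S - A. Z (insert x A))" by simp
    also have "\<dots> = (\<Sum>y\<in>S - A. \<Sum>\<sigma>\<in>?\<Pi>. (1 / 2) ^ ?h A \<sigma> * (if \<sigma> y \<in> B then 1 / 2 else 1))"
      by (intro sum.cong refl swap)
    also have "\<dots> = (\<Sum>\<sigma>\<in>?\<Pi>. (1 / 2) ^ ?h A \<sigma> * (\<Sum>y\<in>S - A. if \<sigma> y \<in> B then 1 / 2 else 1))"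
      by (subst sum.swap) (simp only: sum_distrib_left)
    also have "\<dots> \<le> (\<Sum>\<sigma>\<in>?\<Pi>. (1 / 2) ^ ?h A \<sigma> * (real (card (S - A)) * (1 - \<beta> / 2)))"
    proof (intro sum_mono mult_left_mono)
      fix \<sigma> assume "\<sigma> \<in> ?\<Pi>"
      then have \<sigma>: "\<sigma> permutes S" by simp
      let ?Y = "{y \<in> S - A. \<sigma> y \<in> B}"
      \<comment> \<open>\<open>B\<close> has \<open>card B\<close> preimages, at most
        \<open>card A\<close> of them in \<open>A\<close>; so at least
        \<open>\<beta> * card S\<close> points of \<open>S - A\<close> are sent into
        \<open>B\<close>.\<close>
      have "B \<subseteq> \<sigma> ` {y \<in> S. \<sigma> y \<in> B}"
      proof
        fix b assume b: "b \<in> B"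
        with S(2) permutes_image[OF \<sigma>] obtain y where "y \<in> S" "b = \<sigma> y" by blast
        with b show "b \<in> \<sigma> ` {y \<in> S. \<sigma> y \<in> B}" by blast
      qed
      then have "card B \<le> card {y \<in> S. \<sigma> y \<in> B}"
        using S(1) by (intro surj_card_le) auto
      also have "\<dots> \<le> card (?Y \<union> A)"
        using S(1) insert.hyps by (intro card_mono) auto
      also have "\<dots> \<le> card ?Y + card A" by (rule card_Un_le)
      finally have "real (card B) \<le> real (card ?Y) + real (card A)" by simp
      moreover have "\<beta> * real (card (S - A)) \<le> \<beta> * real (card S)"
        using \<open>0 \<le> \<beta>\<close> cardSA by (intro mult_left_mono) auto
      ultimately have Y: "\<beta> * real (card (S - A)) \<le> real (card ?Y)"
        using insert.prems insert.hyps by simp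
      have "(\<Sum>y\<in>S - A. if \<sigma> y \<in> B then 1 / 2 else 1) = (\<Sum>y\<in>S - A. 1 - 1 / 2 * (if \<sigma> y \<in> B then 1 else (0::real)))"
        by (intro sum.cong) auto
      also have "\<dots> = real (card (S - A)) - 1 / 2 * real (card ?Y)"
        using S(1) by (simp add: sum_subtractf sum.inter_filter[symmetric] flip: sum_divide_distrib)
      also have "\<dots> \<le> real (card (S - A)) * (1 - \<beta> / 2)"
        using Y by (simp add: algebra_simps)
      finally show "(\<Sum>y\<in>S - A. if \<sigma> y \<in> B then 1 / 2 else 1) \<le> real (card (S - A)) * (1 - \<beta> / 2)" .
    qed auto
    also have "\<dots> = real (card (S - A)) * (1 - \<beta> / 2) * Z A"
      by (simp add: Z_def sum_distrib_left mult_ac)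
    finally have "real (card (S - A)) * Z (insert x A) \<le> real (card (S - A)) * ((1 - \<beta> / 2) * Z A)"
      by (simp add: mult_ac)
    then have "Z (insert x A) \<le> (1 - \<beta> / 2) * Z A"
      using cardSA AS by (subst (asm) mult_le_cancel_left_pos) auto
    also have "\<dots> \<le> (1 - \<beta> / 2) * (fact (card S) * (1 - \<beta> / 2) ^ card A)"
    proof (intro mult_left_mono)
      show "Z A \<le> fact (card S) * (1 - \<beta> / 2) ^ card A"
        unfolding Z_def using insert.prems insert.hyps by (intro insert.IH) auto
      have "\<beta> * real (card S) \<le> real (card S)"
        using insert.prems card_mono[OF S] by (meson le_diff_eq of_nat_0_le_iff of_nat_mono order_trans diff_le_eq le_add_same_cancel1)
      then have "\<beta> \<le> 1" using AS by (simp add: mult_le_cancel_right1)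
      then show "0 \<le> 1 - \<beta> / 2" by simp
    qed
    finally show ?case using insert.hyps by (simp add: Z_def mult_ac)
  qed
qed

definition random_permutation :: "nat \<Rightarrow> (nat \<Rightarrow> nat) pmf" where
  "random_permutation n = pmf_of_set {\<sigma>. \<sigma> permutes {..<n}}"

lemma permutations_nonempty: "{\<sigma>. \<sigma> permutes S} \<noteq> {}"
  using permutes_id by blast

text \<open>Markov's inequality for the exponential moment. That moment is at most
  \<open>exp (- 2 * s)\<close> with \<open>s = \<alpha> / 8 * card A\<close>, and on the bad event
  the variable is at least \<open>exp (- s)\<close>, which leaves \<open>exp (- s)\<close>.\<close>

lemma prob_permutation_few_hits_le:
  fixes \<alpha> :: real
  assumes "A \<subseteq> {..<n}" "B \<subseteq> {..<n}" "0 \<le> \<alpha>" "\<alpha> * real n \<le> real (card B)" "real (card A) \<le> \<alpha> / 2 * real n"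
  shows "measure_pmf.prob (random_permutation n)
           {\<sigma>. real (card {x \<in> A. \<sigma> x \<in> B}) < \<alpha> / 8 * real (card A)} \<le> exp (- (\<alpha> / 8 * real (card A)))"
proof -
  let ?\<Pi> = "{\<sigma>. \<sigma> permutes {..<n}}"
  let ?h = "\<lambda>\<sigma>. card {x \<in> A. \<sigma> x \<in> B}"
  let ?s = "\<alpha> / 8 * real (card A)"
  let ?bad = "{\<sigma> \<in> ?\<Pi>. real (?h \<sigma>) < ?s}"
  have finP: "finite ?\<Pi>" by (simp add: finite_permutations)
  \<comment> \<open>This keeps \<open>1 - \<alpha> / 4\<close> nonnegative for the comparison of
    powers below.\<close>
  have "n > 0 \<Longrightarrow> \<alpha> \<le> 1"
  proof -
    assume "n > 0"
    have "\<alpha> * real n \<le> 1 * real n" using assms(4) card_mono[OF _ assms(2)] by simp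
    then show "\<alpha> \<le> 1" using \<open>n > 0\<close> by simp
  qed
  then have \<alpha>1: "card A > 0 \<Longrightarrow> \<alpha> \<le> 1" using assms(1) by (cases "n = 0") auto
  have "real (card ?bad) * exp (- ?s) = (\<Sum>\<sigma>\<in>?bad. exp (- ?s))" by simp
  also have "\<dots> \<le> (\<Sum>\<sigma>\<in>?bad. (1 / 2) ^ ?h \<sigma>)"
  proof (intro sum_mono)
    fix \<sigma> assume "\<sigma> \<in> ?bad"
    then have "exp (- ?s) \<le> exp (- real (?h \<sigma>))" by simp
    also have "\<dots> = exp (- 1) ^ ?h \<sigma>" by (simp flip: exp_of_nat_mult)
    also have "\<dots> \<le> (1 / 2) ^ ?h \<sigma>"
    proof (intro power_mono)
      have "(2::real) \<le> exp 1" using exp_ge_add_one_self[of 1] by simp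
      then show "exp (- 1 :: real) \<le> 1 / 2" by (simp add: exp_minus field_simps)
    qed auto
    finally show "exp (- ?s) \<le> (1 / 2) ^ ?h \<sigma>" .
  qed
  also have "\<dots> \<le> (\<Sum>\<sigma>\<in>?\<Pi>. (1 / 2) ^ ?h \<sigma>)" by (intro sum_mono2 finP) auto
  \<comment> \<open>Here \<open>\<beta> = \<alpha> / 2\<close>: \<open>B\<close> has at least
    \<open>\<alpha> * n\<close> elements and \<open>A\<close> at most
    \<open>\<alpha> / 2 * n\<close>.\<close>
  also have "\<dots> \<le> fact (card {..<n}) * (1 - (\<alpha> / 2) / 2) ^ card A"
    using assms by (intro sum_permutations_half_power_hits_le) (auto simp: field_simps)
  also have "\<dots> \<le> fact n * exp (- (2 * ?s))"
  proof -
    have "(1 - \<alpha> / 2 / 2) ^ card A \<le> exp (- (\<alpha> / 4)) ^ card A"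
    proof (cases "card A > 0")
      case True
      then show ?thesis using exp_ge_add_one_self[of "- (\<alpha> / 4)"] \<alpha>1
        by (intro power_mono) auto
    qed simp
    also have "\<dots> = exp (- (2 * ?s))" by (simp add: mult_ac flip: exp_of_nat_mult)
    finally show ?thesis by simp
  qed
  also have "\<dots> = fact n * exp (- ?s) * exp (- ?s)" by (simp flip: exp_add)
  finally have "real (card ?bad) \<le> fact n * exp (- ?s)"
    by (subst (asm) mult_le_cancel_right_pos) auto
  moreover have "measure_pmf.prob (random_permutation n) {\<sigma>. real (?h \<sigma>) < ?s} = real (card ?bad) / fact n"
  proof -
    have "?\<Pi> \<inter> {\<sigma>. real (?h \<sigma>) < ?s} = ?bad" by auto
    then show ?thesis unfolding random_permutation_def
      by (simp add: measure_pmf_of_set[OF permutations_nonempty finP] card_permutations)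
  qed
  ultimately show ?thesis by (simp only: pos_divide_le_eq fact_gt_zero mult.commute)
qed

section \<open>Independent permutations of several classes\<close>

text \<open>The default \<open>id\<close> fixes all classes outside \<open>J\<close>, as
  \<open>relabel_random_partite_graph\<close> requires.\<close>

definition random_permutations :: "nat set \<Rightarrow> nat \<Rightarrow> (nat \<Rightarrow> nat \<Rightarrow> nat) pmf" where
  "random_permutations J n = Pi_pmf J id (\<lambda>_. random_permutation n)"

lemma set_random_permutations:
  assumes "finite J" "\<sigma> \<in> set_pmf (random_permutations J n)"
  shows "j \<in> J \<Longrightarrow> \<sigma> j permutes {..<n}" and "j \<notin> J \<Longrightarrow> \<sigma> j = id"
  using assms permutations_nonempty[of "{..<n}"]
  by (auto simp: random_permutations_def set_Pi_pmf PiE_dflt_def random_permutation_def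
      set_pmf_of_set finite_permutations)

text \<open>The permutations are revealed one class at a time. Each keeps at least an
  \<open>\<alpha> / 8\<close> fraction of the tiles surviving so far, whose vertices in the new
  class are distinct; the failure probabilities add up.\<close>

lemma prob_permutations_few_hits_le:
  fixes \<alpha> :: real and \<tau> :: "'k \<Rightarrow> nat \<Rightarrow> nat"
  assumes \<alpha>: "0 \<le> \<alpha>" "\<alpha> \<le> 1" and A: "finite A" "real (card A) \<le> \<alpha> / 2 * real n"
    and J: "finite J" "card J \<le> r"
    and \<tau>: "\<And>j. j \<in> J \<Longrightarrow> inj_on (\<lambda>k. \<tau> k j) A" "\<And>j k. j \<in> J \<Longrightarrow> k \<in> A \<Longrightarrow> \<tau> k j < n"
    and N: "\<And>j. j \<in> J \<Longrightarrow> N j \<subseteq> {..<n}" "\<And>j. j \<in> J \<Longrightarrow> \<alpha> * real n \<le> real (card (N j))"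
  shows "measure_pmf.prob (random_permutations J n)
      {\<sigma>. real (card {k \<in> A. \<forall>j\<in>J. \<sigma> j (\<tau> k j) \<in> N j}) < (\<alpha> / 8) ^ card J * real (card A)} \<le>
    real (card J) * exp (- ((\<alpha> / 8) ^ r * real (card A)))"
  using J \<tau> N
proof (induction J rule: finite_induct)
  case empty
  then show ?case by simp
next
  case (insert i J)
  let ?\<eta> = "\<alpha> / 8" and ?a = "real (card A)"
  let ?hit = "\<lambda>J \<sigma>. {k \<in> A. \<forall>j\<in>J. \<sigma> j (\<tau> k j) \<in> N j}"
  let ?q = "exp (- (?\<eta> ^ r * ?a))"
  let ?X = "{\<sigma>. real (card (?hit (insert i J) \<sigma>)) < ?\<eta> ^ card (insert i J) * ?a}"
  let ?B = "{\<sigma>. real (card (?hit J \<sigma>)) < ?\<eta> ^ card J * ?a}"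
  \<comment> \<open>The order of drawing is exchanged so that the permutation of class
    \<open>i\<close> comes last and acts on a set of survivors already fixed.\<close>
  have bind: "random_permutations (insert i J) n =
      bind_pmf (random_permutations J n) (\<lambda>\<sigma>. map_pmf (\<lambda>\<pi>. \<sigma>(i := \<pi>)) (random_permutation n))"
    unfolding random_permutations_def Pi_pmf_insert'[OF insert.hyps] map_pmf_def
    by (rule bind_commute_pmf)
  have step: "measure_pmf.prob (map_pmf (\<lambda>\<pi>. \<sigma>(i := \<pi>)) (random_permutation n)) ?X \<le> ?q"
    if \<sigma>: "\<sigma> \<notin> ?B" for \<sigma>
  proof -
    define A' where "A' = (\<lambda>k. \<tau> k i) ` ?hit J \<sigma>"
    have inj: "inj_on (\<lambda>k. \<tau> k i) (?hit J \<sigma>)"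
      using insert.prems(2)[of i] by (auto intro: inj_on_subset)
    have cardA': "card A' = card (?hit J \<sigma>)"
      unfolding A'_def by (rule card_image[OF inj])
    have hits: "card (?hit (insert i J) (\<sigma>(i := \<pi>))) = card {x \<in> A'. \<pi> x \<in> N i}" for \<pi>
    proof -
      have "\<forall>j\<in>J. j \<noteq> i" using insert.hyps by auto
      then have "{x \<in> A'. \<pi> x \<in> N i} = (\<lambda>k. \<tau> k i) ` ?hit (insert i J) (\<sigma>(i := \<pi>))"
        unfolding A'_def by auto
      moreover have "inj_on (\<lambda>k. \<tau> k i) (?hit (insert i J) (\<sigma>(i := \<pi>)))"
        using insert.prems(2)[of i] by (auto intro: inj_on_subset)
      ultimately show ?thesis by (simp add: card_image)
    qed
    have big: "?\<eta> ^ card J * ?a \<le> real (card A')" using \<sigma> by (simp add: cardA' not_less)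
    then have big': "?\<eta> ^ card (insert i J) * ?a \<le> ?\<eta> * real (card A')"
      using insert.hyps mult_left_mono[OF big, of ?\<eta>] \<alpha> by (simp add: mult_ac)
    have "card A' \<le> card A" unfolding cardA' using A by (intro card_mono) auto
    then have "real (card A') \<le> \<alpha> / 2 * real n" using A(2) by linarith
    then have "measure_pmf.prob (random_permutation n)
        {\<pi>. real (card {x \<in> A'. \<pi> x \<in> N i}) < ?\<eta> * real (card A')} \<le> exp (- (?\<eta> * real (card A')))"
      using insert.prems \<alpha> by (intro prob_permutation_few_hits_le) (auto simp: A'_def)
    also have "\<dots> \<le> ?q"
    proof -
      have "?\<eta> ^ r \<le> ?\<eta> ^ card (insert i J)"
        using \<alpha> insert.prems(1) by (intro power_decreasing) auto
      then have "?\<eta> ^ r * ?a \<le> ?\<eta> ^ card (insert i J) * ?a" by (intro mult_right_mono) auto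
      with big' show ?thesis by simp
    qed
    finally have "measure_pmf.prob (random_permutation n)
        {\<pi>. real (card {x \<in> A'. \<pi> x \<in> N i}) < ?\<eta> * real (card A')} \<le> ?q" .
    moreover have "measure_pmf.prob (map_pmf (\<lambda>\<pi>. \<sigma>(i := \<pi>)) (random_permutation n)) ?X \<le>
      measure_pmf.prob (random_permutation n) {\<pi>. real (card {x \<in> A'. \<pi> x \<in> N i}) < ?\<eta> * real (card A')}"
      unfolding measure_map_pmf vimage_def mem_Collect_eq hits
      using big' by (intro measure_pmf.finite_measure_mono) auto
    ultimately show ?thesis by linarith
  qed
  have "measure_pmf.prob (random_permutations (insert i J) n) ?X \<le>
      measure_pmf.prob (random_permutations J n) ?B + ?q"
    unfolding bind by (intro prob_bind_pmf_le step) auto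
  also have "measure_pmf.prob (random_permutations J n) ?B \<le> real (card J) * ?q"
    using insert.prems insert.hyps by (intro insert.IH) auto
  finally show ?case using insert.hyps by (simp add: algebra_simps)
qed

section \<open>Completing an almost perfect tiling\<close>

text \<open>Covering comes for free: \<open>n\<close> distinct entries below \<open>n\<close>
  exhaust a class.\<close>

lemma has_perfect_tiling_of_tiles:
  assumes "\<And>k. k < n \<Longrightarrow> tile_edges r (\<tau> k) \<subseteq> E"
    and "\<And>i k. i < r \<Longrightarrow> k < n \<Longrightarrow> \<tau> k i < n"
    and inj: "\<And>i. i < r \<Longrightarrow> inj_on (\<lambda>k. \<tau> k i) {..<n}"
  shows "has_perfect_tiling r (verts r n) E"
proof -
  define t where "t = (\<lambda>k. (\<lambda>i. (i, \<tau> k i)) ` {..<r})"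
  have surj: "(\<lambda>k. \<tau> k i) ` {..<n} = {..<n}" if "i < r" for i
    using assms(2) that inj[OF that] by (intro endo_inj_surj) auto
  have "spans_complete r E (t k)" if "k < n" for k
  proof -
    have "card (t k) = r" unfolding t_def by (subst card_image) (auto simp: inj_on_def)
    then show ?thesis
      using assms(1)[OF that] by (auto simp: spans_complete_def t_def tile_edges_subset_iff)
  qed
  moreover have "disjoint (t ` {..<n})"
    unfolding disjoint_def
  proof (intro ballI impI)
    fix a b assume "a \<in> t ` {..<n}" "b \<in> t ` {..<n}" "a \<noteq> b"
    then obtain k l where kl: "k < n" "l < n" "a = t k" "b = t l" "k \<noteq> l" by auto
    show "a \<inter> b = {}"
    proof (rule ccontr)
      assume "a \<inter> b \<noteq> {}"
      then obtain i where "i < r" "\<tau> k i = \<tau> l i" using kl by (auto simp: t_def)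
      with inj[of i] kl show False by (auto dest: inj_onD)
    qed
  qed
  moreover have "\<Union> (t ` {..<n}) = verts r n"
  proof
    show "\<Union> (t ` {..<n}) \<subseteq> verts r n"
      using assms(2) by (auto simp: t_def verts_def vclass_def)
    show "verts r n \<subseteq> \<Union> (t ` {..<n})"
    proof
      fix v assume "v \<in> verts r n"
      then obtain i x where v: "v = (i, x)" "i < r" "x < n" by (auto simp: verts_def vclass_def)
      then obtain k where "k < n" "x = \<tau> k i" using surj[of i] by blast
      with v show "v \<in> \<Union> (t ` {..<n})" by (auto simp: t_def)
    qed
  qed
  ultimately show ?thesis
    unfolding has_perfect_tiling_def by (intro exI[of _ "t ` {..<n}"]) auto
qed

text \<open>Greedy choice. Before the last of \<open>m\<close> tiles is chosen,
  \<open>n - (m - 1) \<ge> s\<close> vertices of each class are still free.\<close>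

lemma clique_rich_almost_tiling:
  assumes rich: "clique_rich r n s H" and "0 < s" and m: "m + s \<le> n + 1"
  shows "\<exists>\<tau>. (\<forall>k<m. tile_edges r (\<tau> k) \<subseteq> H \<and> (\<forall>i<r. \<tau> k i < n)) \<and>
             (\<forall>i<r. inj_on (\<lambda>k. \<tau> k i) {..<m})"
  using m
proof (induction m)
  case (Suc m)
  then obtain \<tau> where \<tau>: "\<And>k. k < m \<Longrightarrow> tile_edges r (\<tau> k) \<subseteq> H"
    "\<And>k i. k < m \<Longrightarrow> i < r \<Longrightarrow> \<tau> k i < n" "\<And>i. i < r \<Longrightarrow> inj_on (\<lambda>k. \<tau> k i) {..<m}"
    by auto
  obtain f where f: "\<And>i. i < r \<Longrightarrow> f i \<in> {..<n} - (\<lambda>k. \<tau> k i) ` {..<m}" "tile_edges r f \<subseteq> H"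
  proof (rule clique_richD[OF rich])
    fix i assume "i < r"
    then have "card ((\<lambda>k. \<tau> k i) ` {..<m}) = m" "(\<lambda>k. \<tau> k i) ` {..<m} \<subseteq> {..<n}"
      using \<tau> by (auto simp: card_image)
    then show "s \<le> card ({..<n} - (\<lambda>k. \<tau> k i) ` {..<m})"
      using Suc.prems by (simp add: card_Diff_subset)
  qed auto
  let ?\<tau> = "\<tau>(m := f)"
  have "\<forall>k<Suc m. tile_edges r (?\<tau> k) \<subseteq> H \<and> (\<forall>i<r. ?\<tau> k i < n)"
    using \<tau>(1,2) f by (auto simp: less_Suc_eq)
  moreover have "inj_on (\<lambda>k. ?\<tau> k i) {..<Suc m}" if "i < r" for i
  proof (rule linorder_inj_onI)
    fix a b assume ab: "a < b" "a \<in> {..<Suc m}" "b \<in> {..<Suc m}"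
    have "f i \<noteq> \<tau> a i" using ab f(1)[OF that] by auto
    then show "?\<tau> a i \<noteq> ?\<tau> b i"
      using ab inj_onD[OF \<tau>(3)[OF that], of a b] by (cases "b = m") auto
  qed auto
  ultimately show ?case by blast
qed simp

text \<open>A vertex \<open>x\<close> of class \<open>i\<close> left over by a tiling can replace the vertex of class \<open>i\<close> of every
  tile whose other vertices are neighbours of \<open>x\<close>. Making such a replacement in each class releases
  \<open>r\<close> vertices, which \<open>clique_rich\<close> allows to be chosen as the vertices of a new tile.\<close>

lemma has_perfect_tiling_by_switching:
  fixes A :: "nat \<Rightarrow> nat set"
  assumes rich: "clique_rich r n s H" and "m \<le> n"
    and \<tau>: "\<And>k. k < m \<Longrightarrow> tile_edges r (\<tau> k) \<subseteq> H" "\<And>k i. k < m \<Longrightarrow> i < r \<Longrightarrow> \<tau> k i < n"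
      "\<And>i. i < r \<Longrightarrow> inj_on (\<lambda>k. \<tau> k i) {..<m}"
    and A: "\<And>i. i < r \<Longrightarrow> A i \<subseteq> {..<m}" "\<And>i j. i < r \<Longrightarrow> j < r \<Longrightarrow> i \<noteq> j \<Longrightarrow> A i \<inter> A j = {}"
    and good: "\<And>i x. i < r \<Longrightarrow> x < n \<Longrightarrow>
      s + (n - m) \<le> card {k \<in> A i. \<forall>j<r. j \<noteq> i \<longrightarrow> {(i, x), (j, \<tau> k j)} \<in> G}"
  shows "has_perfect_tiling r (verts r n) (G \<union> H)"
proof -
  \<comment> \<open>Induction on the number \<open>l\<close> of leftover vertices absorbed in each
    class. \<open>U i\<close> records the tiles of \<open>A i\<close> already spent; the rest of
    \<open>A i\<close> is still in its original state, so \<open>good\<close> continues to apply to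
    it.\<close>
  have "\<exists>\<tau>' U. (\<forall>k<m + l. tile_edges r (\<tau>' k) \<subseteq> G \<union> H \<and> (\<forall>i<r. \<tau>' k i < n)) \<and>
      (\<forall>i<r. inj_on (\<lambda>k. \<tau>' k i) {..<m + l}) \<and> (\<forall>i<r. finite (U i) \<and> card (U i) \<le> l) \<and>
      (\<forall>i<r. \<forall>k\<in>A i - U i. \<forall>j<r. \<tau>' k j = \<tau> k j)" if "l \<le> n - m" for l
    using that
  proof (induction l)
    case 0
    have "tile_edges r (\<tau> k) \<subseteq> G \<union> H" if "k < m" for k using \<tau>(1)[OF that] by blast
    then show ?case
      using \<tau>(2,3) by (intro exI[of _ \<tau>] exI[of _ "\<lambda>_. {}"] conjI allI impI ballI) simp_all
  next
    case (Suc l)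
    obtain \<tau>' and U :: "nat \<Rightarrow> nat set" where
      1: "\<forall>k<m + l. tile_edges r (\<tau>' k) \<subseteq> G \<union> H \<and> (\<forall>i<r. \<tau>' k i < n)"
      and 2: "\<forall>i<r. inj_on (\<lambda>k. \<tau>' k i) {..<m + l}" and 3: "\<forall>i<r. finite (U i) \<and> card (U i) \<le> l"
      and 4: "\<forall>i<r. \<forall>k\<in>A i - U i. \<forall>j<r. \<tau>' k j = \<tau> k j"
      using Suc.IH[OF Suc_leD[OF Suc.prems]] by (elim exE conjE)
    have \<tau>': "\<And>k. k < m + l \<Longrightarrow> tile_edges r (\<tau>' k) \<subseteq> G \<union> H" "\<And>k i. k < m + l \<Longrightarrow> i < r \<Longrightarrow> \<tau>' k i < n"
        "\<And>i. i < r \<Longrightarrow> inj_on (\<lambda>k. \<tau>' k i) {..<m + l}"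
      and U: "\<And>i. i < r \<Longrightarrow> finite (U i)" "\<And>i. i < r \<Longrightarrow> card (U i) \<le> l"
      and unchanged: "\<And>i k j. i < r \<Longrightarrow> k \<in> A i - U i \<Longrightarrow> j < r \<Longrightarrow> \<tau>' k j = \<tau> k j"
      using 1 2 3 4 by simp_all
    have "\<exists>x<n. x \<notin> (\<lambda>k. \<tau>' k i) ` {..<m + l}" if "i < r" for i
    proof (rule ccontr)
      assume "\<not> ?thesis"
      then have "{..<n} \<subseteq> (\<lambda>k. \<tau>' k i) ` {..<m + l}" by auto
      then have "card {..<n} \<le> card {..<m + l}" by (intro surj_card_le) auto
      then show False using Suc.prems by simp
    qed
    then obtain x where x: "\<And>i. i < r \<Longrightarrow> x i < n" "\<And>i. i < r \<Longrightarrow> x i \<notin> (\<lambda>k. \<tau>' k i) ` {..<m + l}"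
      by metis
    \<comment> \<open>\<open>good\<close> offers \<open>s + (n - m)\<close> tiles and fewer than
      \<open>n - m\<close> are spent, so \<open>s\<close> usable ones remain. Richness is applied to
      the vertices that these tiles would release.\<close>
    define W where "W = (\<lambda>i. {k \<in> A i. \<forall>j<r. j \<noteq> i \<longrightarrow> {(i, x i), (j, \<tau> k j)} \<in> G} - U i)"
    have W: "W i \<subseteq> {..<m}" if "i < r" for i using A(1)[OF that] by (auto simp: W_def)
    obtain f where f: "\<And>i. i < r \<Longrightarrow> f i \<in> (\<lambda>k. \<tau> k i) ` W i" "tile_edges r f \<subseteq> H"
    proof (rule clique_richD[OF rich])
      fix i assume i: "i < r"
      show "(\<lambda>k. \<tau> k i) ` W i \<subseteq> {..<n}" using W[OF i] \<tau>(2) i by auto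
      have "s + (n - m) - card (U i) \<le> card (W i)"
        using good[OF i x(1)[OF i]] diff_card_le_card_Diff[OF U(1)[OF i]] unfolding W_def
        by (meson diff_le_mono order_trans)
      then have "s \<le> card (W i)" using U(2)[OF i] Suc.prems by linarith
      also have "card (W i) = card ((\<lambda>k. \<tau> k i) ` W i)"
        using \<tau>(3)[OF i] W[OF i] by (intro card_image[symmetric]) (rule inj_on_subset)
      finally show "s \<le> card ((\<lambda>k. \<tau> k i) ` W i)" .
    qed blast
    then have "\<forall>i<r. \<exists>k. k \<in> W i \<and> f i = \<tau> k i" by blast
    then obtain K where K: "\<And>i. i < r \<Longrightarrow> K i \<in> W i" "\<And>i. i < r \<Longrightarrow> f i = \<tau> (K i) i"
      by metis
    have KA: "K i \<in> A i - U i" "K i < m" if "i < r" for i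
      using K(1)[OF that] W[OF that] by (auto simp: W_def)
    \<comment> \<open>Disjointness of the sets \<open>A i\<close> prevents a tile from being chosen
      for two classes, so each altered tile has exactly one vertex exchanged.\<close>
    have Keq: "i = j" if "i < r" "j < r" "k \<in> A i" "k = K j" for i j k
      using that KA(1)[of j] A(2)[of i j] by auto
    have fK: "f i = \<tau>' (K i) i" if "i < r" for i
      using K(2)[OF that] unchanged[OF that KA(1)[OF that] that] by simp
    \<comment> \<open>The released vertices \<open>f\<close> become the new tile number
      \<open>m + l\<close>, and \<open>x i\<close> takes the place of \<open>f i\<close> in tile
      \<open>K i\<close>.\<close>
    define \<rho> where "\<rho> = (\<lambda>k. if k = m + l then f else (\<lambda>i. if k = K i then x i else \<tau>' k i))"
    have "tile_edges r (\<rho> k) \<subseteq> G \<union> H" if k: "k < m + Suc l" for k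
    proof (cases "k = m + l")
      case True
      then show ?thesis using f(2) by (auto simp: \<rho>_def)
    next
      case False
      then have kl: "k < m + l" using k by simp
      show ?thesis
      proof (cases "\<exists>i<r. k = K i")
        case True
        then obtain i where i: "i < r" "k = K i" by blast
        have \<rho>: "\<rho> k j = (if j = i then x i else \<tau> k j)" if "j < r" for j
        proof -
          have "k \<in> A i" using i KA(1)[of i] by simp
          then have "j = i" if "k = K j" using Keq[of i j k] i(1) \<open>j < r\<close> that by simp
          moreover have "\<tau>' k j = \<tau> k j"
            using unchanged[OF i(1) KA(1)[OF i(1)] \<open>j < r\<close>] i(2) by simp
          ultimately show ?thesis
            using False i(2) by (cases "j = i") (auto simp: \<rho>_def)
        qed
        have x_edge: "{(i, x i), (j, \<tau> k j)} \<in> G" if "j < r" "j \<noteq> i" for j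
          using K(1)[OF i(1)] i(2) that by (auto simp: W_def)
        have old: "{(a, \<tau> k a), (b, \<tau> k b)} \<in> H" if "a < r" "b < r" "a \<noteq> b" for a b
          using \<tau>(1)[of k] KA(2)[OF i(1)] i(2) that by (auto simp: tile_edges_subset_iff)
        show ?thesis unfolding tile_edges_subset_iff
        proof (intro allI impI)
          fix a b assume ab: "a < r" "b < r" "a \<noteq> b"
          then show "{(a, \<rho> k a), (b, \<rho> k b)} \<in> G \<union> H"
            using x_edge[of a] x_edge[of b] old[of a b]
            by (cases "a = i"; cases "b = i") (auto simp: \<rho> insert_commute)
        qed
      next
        case noK: False
        then have "tile_edges r (\<rho> k) = tile_edges r (\<tau>' k)"
          using False by (intro tile_edges_cong) (auto simp: \<rho>_def)
        then show ?thesis using \<tau>'(1)[OF kl] by simp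
      qed
    qed
    moreover have "\<rho> k i < n" if "k < m + Suc l" "i < r" for k i
      using that x(1)[of i] \<tau>'(2)[of k i] \<tau>'(2)[of "K i" i] fK[of i] KA(2)[of i]
      by (auto simp: \<rho>_def)
    moreover have "inj_on (\<lambda>k. \<rho> k i) {..<m + Suc l}" if i: "i < r" for i
    proof -
      note inj = inj_onD[OF \<tau>'(3)[OF i]]
      have xi: "x i \<noteq> \<tau>' k i" if "k < m + l" for k using x(2)[OF i] that by auto
      have Ki: "K i < m + l" using KA(2)[OF i] by simp
      show ?thesis
      proof (rule linorder_inj_onI)
        fix a b assume ab: "a < b" "a \<in> {..<m + Suc l}" "b \<in> {..<m + Suc l}"
        then have a: "a < m + l" by simp
        show "\<rho> a i \<noteq> \<rho> b i"
        proof (cases "b = m + l")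
          case True
          then show ?thesis using a xi[OF Ki] inj[of a "K i"] Ki
            by (auto simp: \<rho>_def fK[OF i])
        next
          case False
          then have b: "b < m + l" using ab by simp
          then show ?thesis using a ab(1) xi[OF a] xi[OF b] inj[of a b]
            by (auto simp: \<rho>_def)
        qed
      qed auto
    qed
    moreover have "\<rho> k j = \<tau> k j" if "i < r" "k \<in> A i - insert (K i) (U i)" "j < r" for i j k
    proof -
      have "k < m" using A(1) that by auto
      moreover have "k \<noteq> K j" using Keq[of i j k] that by auto
      ultimately show ?thesis using unchanged[of i k j] that by (auto simp: \<rho>_def)
    qed
    moreover have "finite (insert (K i) (U i)) \<and> card (insert (K i) (U i)) \<le> Suc l" if "i < r" for i
      using U(1)[OF that] U(2)[OF that] by (simp add: card_insert_if)
    ultimately show ?case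
      by (intro exI[of _ \<rho>] exI[of _ "\<lambda>i. insert (K i) (U i)"] conjI allI impI ballI) simp_all
  qed
  from this[of "n - m"] obtain \<tau>' where
    "\<And>k. k < n \<Longrightarrow> tile_edges r (\<tau>' k) \<subseteq> G \<union> H" "\<And>k i. k < n \<Longrightarrow> i < r \<Longrightarrow> \<tau>' k i < n"
    "\<And>i. i < r \<Longrightarrow> inj_on (\<lambda>k. \<tau>' k i) {..<n}"
    using \<open>m \<le> n\<close> by auto
  then show ?thesis by (rule has_perfect_tiling_of_tiles)
qed

section \<open>Degrees\<close>

lemma edges_between_commute: "edges_between E A B = edges_between E B A"
  unfolding edges_between_def by (metis (no_types, lifting) insert_commute)

lemma vertex_degree_edges_between:
  assumes "i \<noteq> j" "x < n"
  shows "vertex_degree (edges_between E (vclass n i) (vclass n j)) (i, x) =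
         card {y. y < n \<and> {(i, x), (j, y)} \<in> E}"
proof -
  have "{e \<in> edges_between E (vclass n i) (vclass n j). (i, x) \<in> e} =
      (\<lambda>y. {(i, x), (j, y)}) ` {y. y < n \<and> {(i, x), (j, y)} \<in> E}"
    using assms by (auto simp: edges_between_def vclass_def)
  moreover have "inj_on (\<lambda>y. {(i, x), (j, y)}) Y" for Y
    using assms by (auto simp: inj_on_def doubleton_eq_iff)
  ultimately show ?thesis by (simp add: vertex_degree_def card_image)
qed

lemma finite_min_degrees:
  "finite {min_degree (vclass n i \<union> vclass n j) (edges_between E (vclass n i) (vclass n j)) | i j.
            i < r \<and> j < r \<and> i \<noteq> j}"
  by (rule finite_subset[of _ "(\<lambda>(i, j). min_degree (vclass n i \<union> vclass n j)
        (edges_between E (vclass n i) (vclass n j))) ` ({..<r} \<times> {..<r})"]) auto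

lemma partite_graphs_degree:
  assumes G: "G \<in> partite_graphs r \<alpha> n" and ij: "i < r" "j < r" "i \<noteq> j" and x: "x < n"
  shows "\<alpha> * real n \<le> real (card {y. y < n \<and> {(i, x), (j, y)} \<in> G})"
proof -
  let ?E = "edges_between G (vclass n i) (vclass n j)"
  have "\<alpha> * real n \<le> real (delta_star r n G)" using G by (simp add: partite_graphs_def)
  also have "delta_star r n G \<le> min_degree (vclass n i \<union> vclass n j) ?E"
    unfolding delta_star_def by (rule Min_le[OF finite_min_degrees]) (use ij in blast)
  also have "\<dots> \<le> vertex_degree ?E (i, x)"
    unfolding min_degree_def using x by (intro Min_le) (auto simp: vclass_def)
  finally show ?thesis
    by (simp add: vertex_degree_edges_between[OF ij(3) x])
qed

lemma le_delta_star:
  assumes "0 < n" "2 \<le> r"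
    and deg: "\<And>i j x. i < r \<Longrightarrow> j < r \<Longrightarrow> i \<noteq> j \<Longrightarrow> x < n \<Longrightarrow>
      d \<le> card {y. y < n \<and> {(i, x), (j, y)} \<in> G}"
  shows "d \<le> delta_star r n G"
proof -
  have "d \<le> min_degree (vclass n i \<union> vclass n j) (edges_between G (vclass n i) (vclass n j))"
    if ij: "i < r" "j < r" "i \<noteq> j" for i j
    unfolding min_degree_def
  proof (intro Min.boundedI)
    fix d' assume "d' \<in> vertex_degree (edges_between G (vclass n i) (vclass n j)) ` (vclass n i \<union> vclass n j)"
    then obtain v where v: "d' = vertex_degree (edges_between G (vclass n i) (vclass n j)) v"
      "v \<in> vclass n i \<or> v \<in> vclass n j" by blast
    from v(2) show "d \<le> d'"
    proof
      assume "v \<in> vclass n i"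
      then obtain x where x: "v = (i, x)" "x < n" by (auto simp: vclass_def)
      then show ?thesis using deg[OF ij x(2)] v(1) ij by (simp add: vertex_degree_edges_between)
    next
      assume "v \<in> vclass n j"
      then obtain x where x: "v = (j, x)" "x < n" by (auto simp: vclass_def)
      then show ?thesis using deg[OF ij(2,1) _ x(2)] v(1) ij
        by (simp add: edges_between_commute[of _ "vclass n i"] vertex_degree_edges_between)
    qed
  qed (use \<open>0 < n\<close> in \<open>auto simp: vclass_def\<close>)
  moreover have "(0::nat) < r \<and> (1::nat) < r \<and> (0::nat) \<noteq> 1" using \<open>2 \<le> r\<close> by simp
  then have "{min_degree (vclass n i \<union> vclass n j) (edges_between G (vclass n i) (vclass n j)) | i j.
            i < r \<and> j < r \<and> i \<noteq> j} \<noteq> {}" by blast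
  ultimately show ?thesis
    unfolding delta_star_def by (intro Min.boundedI finite_min_degrees) auto
qed

section \<open>Above the threshold\<close>

definition relabel :: "(nat \<Rightarrow> nat \<Rightarrow> nat) \<Rightarrow> vertex \<Rightarrow> vertex" where
  "relabel \<sigma> = (\<lambda>(i, x). (i, \<sigma> i x))"

lemma tile_edges_relabel: "tile_edges r (\<lambda>i. \<sigma> i (f i)) = (`) (relabel \<sigma>) ` tile_edges r f"
  by (simp add: tile_edges_def image_image relabel_def)

text \<open>Permuting inside the classes keeps endpoints in different classes, so it induces a
  bijection of \<open>cross_pairs r n\<close>, under which the product measure is invariant.\<close>

lemma relabel_random_partite_graph:
  assumes \<sigma>: "\<And>i. i < r \<Longrightarrow> \<sigma> i permutes {..<n}" "\<And>i. \<not> i < r \<Longrightarrow> \<sigma> i = id"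
  shows "map_pmf ((`) ((`) (relabel \<sigma>))) (random_partite_graph r n p) = random_partite_graph r n p"
proof -
  have "inj (\<sigma> i)" for i using \<sigma>[of i] permutes_inj by (cases "i < r") auto
  then have "inj (relabel \<sigma>)" by (auto simp: relabel_def inj_def)
  then have inj: "inj_on ((`) (relabel \<sigma>)) (cross_pairs r n)"
    by (simp add: inj_on_def inj_image_eq_iff)
  have "(`) (relabel \<sigma>) ` cross_pairs r n \<subseteq> cross_pairs r n"
  proof
    fix e assume "e \<in> (`) (relabel \<sigma>) ` cross_pairs r n"
    then obtain i j x y where e: "i < r" "j < r" "x < n" "y < n" "i \<noteq> j"
      "e = relabel \<sigma> ` {(i, x), (j, y)}"
      by (auto simp: mem_cross_pairs_iff)
    moreover have "\<sigma> i x < n" "\<sigma> j y < n"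
      using e permutes_in_image[OF \<sigma>(1)[OF e(1)]] permutes_in_image[OF \<sigma>(1)[OF e(2)]] by auto
    ultimately show "e \<in> cross_pairs r n"
      unfolding mem_cross_pairs_iff by (auto simp: relabel_def)
  qed
  then have "bij_betw ((`) (relabel \<sigma>)) (cross_pairs r n) (cross_pairs r n)"
    using inj endo_inj_surj[OF finite_cross_pairs] by (auto simp: bij_betw_def)
  then show ?thesis
    unfolding random_partite_graph_eq by (rule random_subset_image[OF finite_cross_pairs])
qed

text \<open>The sets \<open>S i\<close> are pulled back along \<open>\<sigma> i\<close>, which does
  not shrink them, and the clique found there is pushed forward.\<close>

lemma clique_rich_relabel:
  assumes \<sigma>: "\<And>i. i < r \<Longrightarrow> \<sigma> i permutes {..<n}" and rich: "clique_rich r n s H"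
  shows "clique_rich r n s ((`) (relabel \<sigma>) ` H)"
  unfolding clique_rich_def
proof (intro allI impI)
  fix S assume S: "\<forall>i<r. S i \<subseteq> {..<n} \<and> s \<le> card (S i)"
  obtain f where f: "\<And>i. i < r \<Longrightarrow> f i \<in> {x \<in> {..<n}. \<sigma> i x \<in> S i}" "tile_edges r f \<subseteq> H"
  proof (rule clique_richD[OF rich])
    fix i assume i: "i < r"
    have "S i \<subseteq> \<sigma> i ` {x \<in> {..<n}. \<sigma> i x \<in> S i}"
    proof
      fix y assume "y \<in> S i"
      then have "y \<in> \<sigma> i ` {..<n}" using S i permutes_image[OF \<sigma>[OF i]] by auto
      with \<open>y \<in> S i\<close> show "y \<in> \<sigma> i ` {x \<in> {..<n}. \<sigma> i x \<in> S i}" by blast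
    qed
    then have "card (S i) \<le> card {x \<in> {..<n}. \<sigma> i x \<in> S i}" by (intro surj_card_le) auto
    then show "s \<le> card {x \<in> {..<n}. \<sigma> i x \<in> S i}" using S i by (meson order_trans)
  qed auto
  have "tile_edges r (\<lambda>i. \<sigma> i (f i)) \<subseteq> (`) (relabel \<sigma>) ` H"
    unfolding tile_edges_relabel using f(2) by blast
  moreover have "\<forall>i<r. \<sigma> i (f i) \<in> S i" using f(1) by simp
  ultimately show "\<exists>f. (\<forall>i<r. f i \<in> S i) \<and> tile_edges r f \<subseteq> (`) (relabel \<sigma>) ` H"
    by (intro exI[of _ "\<lambda>i. \<sigma> i (f i)"] conjI)
qed

text \<open>Here \<open>H\<close> is fixed and only the relabelling is random. A union bound over
  the \<open>r * n\<close> vertices ensures that every vertex can enter enough tiles of its block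
  for switching to succeed.\<close>

lemma prob_no_perfect_tiling_relabel_le:
  assumes G: "G \<in> partite_graphs r \<alpha> n" and \<alpha>: "0 < \<alpha>" "\<alpha> \<le> 1" and rich: "clique_rich r n s H"
    and s: "0 < s" and a: "r * a + s \<le> n + 1" "real a \<le> \<alpha> / 2 * real n"
      "2 * real s \<le> (\<alpha> / 8) ^ r * real a"
  shows "measure_pmf.prob (random_permutations {..<r} n)
      {\<sigma>. \<not> has_perfect_tiling r (verts r n) (G \<union> (`) (relabel \<sigma>) ` H)}
    \<le> real r * real n * (real r * exp (- ((\<alpha> / 8) ^ r * real a)))"
proof -
  \<comment> \<open>This leaves \<open>n - m = s - 1\<close> vertices in each class, so the
    \<open>s + (n - m)\<close> tiles required for switching are fewer than
    \<open>2 * s\<close>.\<close>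
  define m where "m = n + 1 - s"
  have m: "m + s \<le> n + 1" "m \<le> n" "n - m < s" "r * a \<le> m" using s a(1) by (auto simp: m_def)
  obtain \<tau> where \<tau>0: "\<forall>k<m. tile_edges r (\<tau> k) \<subseteq> H \<and> (\<forall>i<r. \<tau> k i < n)"
    "\<forall>i<r. inj_on (\<lambda>k. \<tau> k i) {..<m}"
    using clique_rich_almost_tiling[OF rich s m(1)] by blast
  then have \<tau>: "\<And>k. k < m \<Longrightarrow> tile_edges r (\<tau> k) \<subseteq> H" "\<And>k i. k < m \<Longrightarrow> i < r \<Longrightarrow> \<tau> k i < n"
    "\<And>i. i < r \<Longrightarrow> inj_on (\<lambda>k. \<tau> k i) {..<m}"
    by simp_all
  \<comment> \<open>The first \<open>r * a\<close> tiles are cut into \<open>r\<close> consecutive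
    blocks of length \<open>a\<close>; block \<open>A i\<close> is reserved for leftover vertices of
    class \<open>i\<close>.\<close>
  define A where "A = (\<lambda>i. {i * a..<Suc i * a})"
  have A: "A i \<subseteq> {..<m}" if "i < r" for i
  proof -
    have "Suc i * a \<le> r * a" using that by (intro mult_le_mono1) simp
    then show ?thesis using m(4) by (auto simp: A_def)
  qed
  have A_disj: "A i \<inter> A j = {}" if "i \<noteq> j" for i j
  proof -
    have "A i \<inter> A j = {}" if "i < j" for i j
    proof -
      have "Suc i * a \<le> j * a" using that by (intro mult_le_mono1) simp
      then show ?thesis by (auto simp: A_def)
    qed
    then show ?thesis using that by (metis Int_commute linorder_neqE_nat)
  qed
  have cardA: "card (A i) = a" for i by (simp add: A_def)
  \<comment> \<open>The own class of \<open>x\<close> imposes no condition; the trivial set for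
    \<open>j = i\<close> allows one index set \<open>{..<r}\<close> for all classes.\<close>
  define N where "N = (\<lambda>i x j. if j = i then {..<n} else {y. y < n \<and> {(i, x), (j, y)} \<in> G})"
  define bad where "bad = (\<lambda>i x. {\<sigma>. real (card {k \<in> A i. \<forall>j\<in>{..<r}. \<sigma> j (\<tau> k j) \<in> N i x j})
      < (\<alpha> / 8) ^ card {..<r} * real (card (A i))})"
  have prob_bad: "measure_pmf.prob (random_permutations {..<r} n) (bad i x) \<le>
      real r * exp (- ((\<alpha> / 8) ^ r * real a))" if "i < r" "x < n" for i x
  proof -
    have "measure_pmf.prob (random_permutations {..<r} n) (bad i x) \<le>
      real (card {..<r}) * exp (- ((\<alpha> / 8) ^ r * real (card (A i))))"
      unfolding bad_def
    proof (rule prob_permutations_few_hits_le)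
      fix j assume j: "j \<in> {..<r}"
      show "inj_on (\<lambda>k. \<tau> k j) (A i)"
        using \<tau>(3) j A[OF that(1)] by (auto intro: inj_on_subset)
      show "\<tau> k j < n" if "k \<in> A i" for k
        using \<tau>(2)[of k j] that j A[OF \<open>i < r\<close>] by auto
      show "N i x j \<subseteq> {..<n}" by (auto simp: N_def)
      have "\<alpha> * real n \<le> 1 * real n" using \<alpha> by (intro mult_right_mono) auto
      then show "\<alpha> * real n \<le> real (card (N i x j))"
        using partite_graphs_degree[OF G that(1) _ _ that(2), of j] j by (auto simp: N_def)
    qed (use \<alpha> a(2) cardA in \<open>auto simp: A_def\<close>)
    then show ?thesis by (simp add: cardA)
  qed
  have tiling: "has_perfect_tiling r (verts r n) (G \<union> (`) (relabel \<sigma>) ` H)"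
    if \<sigma>: "\<sigma> \<in> set_pmf (random_permutations {..<r} n)"
      and not_bad: "\<And>i x. i < r \<Longrightarrow> x < n \<Longrightarrow> \<sigma> \<notin> bad i x" for \<sigma>
  proof (rule has_perfect_tiling_by_switching[where \<tau> = "\<lambda>k i. \<sigma> i (\<tau> k i)" and A = A and m = m])
    have perm: "\<sigma> i permutes {..<n}" if "i < r" for i
      using set_random_permutations(1)[OF _ \<sigma>] that by simp
    show "clique_rich r n s ((`) (relabel \<sigma>) ` H)"
      by (rule clique_rich_relabel[OF perm rich])
    show "tile_edges r (\<lambda>i. \<sigma> i (\<tau> k i)) \<subseteq> (`) (relabel \<sigma>) ` H" if "k < m" for k
      unfolding tile_edges_relabel using \<tau>(1)[OF that] by blast
    show "\<sigma> i (\<tau> k i) < n" if "k < m" "i < r" for k i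
      using permutes_in_image[OF perm[OF that(2)]] \<tau>(2)[OF that] by simp
    show "inj_on (\<lambda>k. \<sigma> i (\<tau> k i)) {..<m}" if "i < r" for i
      using inj_on_imageI2 comp_inj_on[OF \<tau>(3)[OF that], of "\<sigma> i"]
        permutes_inj_on[OF perm[OF that]] by (simp add: comp_def)
    show "A i \<subseteq> {..<m}" if "i < r" for i by (rule A[OF that])
    show "A i \<inter> A j = {}" if "i < r" "j < r" "i \<noteq> j" for i j by (rule A_disj[OF that(3)])
    show "s + (n - m) \<le> card {k \<in> A i. \<forall>j<r. j \<noteq> i \<longrightarrow> {(i, x), (j, \<sigma> j (\<tau> k j))} \<in> G}"
      if "i < r" "x < n" for i x
    proof -
      have "2 * real s \<le> real (card {k \<in> A i. \<forall>j\<in>{..<r}. \<sigma> j (\<tau> k j) \<in> N i x j})"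
        using not_bad[OF that] a(3) by (simp add: bad_def cardA)
      also have "card {k \<in> A i. \<forall>j\<in>{..<r}. \<sigma> j (\<tau> k j) \<in> N i x j} \<le>
          card {k \<in> A i. \<forall>j<r. j \<noteq> i \<longrightarrow> {(i, x), (j, \<sigma> j (\<tau> k j))} \<in> G}"
        by (intro card_mono) (auto simp: A_def N_def split: if_splits)
      finally show ?thesis using m(3) by linarith
    qed
  qed (use m(2) in simp)
  let ?X = "{\<sigma>. \<not> has_perfect_tiling r (verts r n) (G \<union> (`) (relabel \<sigma>) ` H)}"
  let ?\<Sigma> = "random_permutations {..<r} n"
  have "measure_pmf.prob ?\<Sigma> ?X = measure_pmf.prob ?\<Sigma> (?X \<inter> set_pmf ?\<Sigma>)"
    by (simp add: measure_Int_set_pmf)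
  also have "\<dots> \<le> measure_pmf.prob ?\<Sigma> (\<Union>z\<in>{..<r} \<times> {..<n}. bad (fst z) (snd z))"
    using tiling by (intro measure_pmf.finite_measure_mono) fastforce+
  also have "\<dots> \<le> (\<Sum>z\<in>{..<r} \<times> {..<n}. measure_pmf.prob ?\<Sigma> (bad (fst z) (snd z)))"
    by (intro measure_pmf.finite_measure_subadditive_finite) auto
  also have "\<dots> \<le> (\<Sum>z\<in>{..<r} \<times> {..<n}. real r * exp (- ((\<alpha> / 8) ^ r * real a)))"
    using prob_bad by (intro sum_mono) auto
  finally show ?thesis by simp
qed

text \<open>Since the random graph is invariant under relabelling the vertices within each class, one may
  first expose it up to such a relabelling and then apply uniformly random permutations.\<close>

lemma prob_no_perfect_tiling_le:
  assumes "G \<in> partite_graphs r \<alpha> n" "0 < \<alpha>" "\<alpha> \<le> 1" "0 < s" "r * a + s \<le> n + 1"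
    "real a \<le> \<alpha> / 2 * real n" "2 * real s \<le> (\<alpha> / 8) ^ r * real a"
  shows "measure_pmf.prob (random_partite_graph r n p) {H. \<not> has_perfect_tiling r (verts r n) (G \<union> H)}
    \<le> measure_pmf.prob (random_partite_graph r n p) {H. \<not> clique_rich r n s H} +
       real r * real n * (real r * exp (- ((\<alpha> / 8) ^ r * real a)))"
proof -
  let ?R = "random_partite_graph r n p" and ?\<Sigma> = "random_permutations {..<r} n"
  have "?R = bind_pmf ?\<Sigma> (\<lambda>_. ?R)" by simp
  also have "\<dots> = bind_pmf ?\<Sigma> (\<lambda>\<sigma>. map_pmf ((`) ((`) (relabel \<sigma>))) ?R)"
  proof (intro bind_pmf_cong refl)
    fix \<sigma> assume \<sigma>: "\<sigma> \<in> set_pmf ?\<Sigma>"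
    show "?R = map_pmf ((`) ((`) (relabel \<sigma>))) ?R"
      using set_random_permutations[OF _ \<sigma>] by (intro relabel_random_partite_graph[symmetric]) auto
  qed
  also have "\<dots> = bind_pmf ?R (\<lambda>H. map_pmf (\<lambda>\<sigma>. (`) (relabel \<sigma>) ` H) ?\<Sigma>)"
    unfolding map_pmf_def by (rule bind_commute_pmf)
  finally have R: "?R = bind_pmf ?R (\<lambda>H. map_pmf (\<lambda>\<sigma>. (`) (relabel \<sigma>) ` H) ?\<Sigma>)" .
  show ?thesis
    by (subst R, rule prob_bind_pmf_le)
       (use prob_no_perfect_tiling_relabel_le[OF assms(1-3) _ assms(4-7)] in \<open>auto simp: vimage_def\<close>)
qed

section \<open>Constants and limits above the threshold\<close>

lemma whp_iff_prob_not_tendsto_0: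
  "whp M Q \<longleftrightarrow> (\<lambda>n. measure_pmf.prob (M n) {x. \<not> Q n x}) \<longlonglongrightarrow> 0"
proof -
  have *: "measure_pmf.prob (M n) {x. \<not> Q n x} = 1 - measure_pmf.prob (M n) {x. Q n x}" for n
    by (subst measure_pmf.prob_compl[symmetric]) (auto intro!: arg_cong[where f = "measure _"])
  show ?thesis
    unfolding whp_def *
  proof
    assume "(\<lambda>n. measure_pmf.prob (M n) {x. Q n x}) \<longlonglongrightarrow> 1"
    from tendsto_diff[OF tendsto_const[of 1] this]
    show "(\<lambda>n. 1 - measure_pmf.prob (M n) {x. Q n x}) \<longlonglongrightarrow> 0" by simp
  next
    assume "(\<lambda>n. 1 - measure_pmf.prob (M n) {x. Q n x}) \<longlonglongrightarrow> 0"
    from tendsto_diff[OF tendsto_const[of 1] this]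
    show "(\<lambda>n. measure_pmf.prob (M n) {x. Q n x}) \<longlonglongrightarrow> 1" by simp
  qed
qed

lemma perfect_tiling_whp:
  assumes r: "r \<ge> 2" and \<alpha>: "0 < \<alpha>" "\<alpha> < 1 / real r"
  shows "\<exists>C>0. \<forall>p. (\<forall>n. 0 \<le> p n \<and> p n \<le> 1) \<and>
      (\<forall>\<^sub>F n in sequentially. p n \<ge> C * real n powr (- 2 / real r)) \<longrightarrow>
    (\<forall>G. (\<forall>n. G n \<in> partite_graphs r \<alpha> n) \<longrightarrow>
      whp (\<lambda>n. random_partite_graph r n (p n)) (\<lambda>n H. has_perfect_tiling r (verts r n) (G n \<union> H)))"
proof -
  have r\<alpha>: "real r * \<alpha> < 1" using \<alpha> r by (simp add: field_simps)
  have \<alpha>1: "\<alpha> < 1"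
  proof -
    have "1 * \<alpha> \<le> real r * \<alpha>" using r \<alpha> by (intro mult_right_mono) auto
    then show ?thesis using r\<alpha> by simp
  qed
  \<comment> \<open>\<open>\<eta>\<close> is the guaranteed fraction of a block that survives all
    \<open>r\<close> neighbourhood conditions. With \<open>a\<close> about
    \<open>\<alpha> * n / 2\<close> and \<open>s\<close> about \<open>\<epsilon> * n\<close>, the
    factor 16 leaves room for \<open>2 * s \<le> \<eta> * a\<close> after rounding.\<close>
  define \<eta> where "\<eta> = (\<alpha> / 8) ^ r"
  define \<epsilon> where "\<epsilon> = \<eta> * \<alpha> / 16"
  \<comment> \<open>Since \<open>C \<ge> 1\<close> and \<open>r choose 2 \<ge> 1\<close>, passing to
    \<open>C ^ (r choose 2)\<close> only helps, and \<open>\<epsilon> ^ r * C / 2 = r + 1\<close> is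
    what \<open>clique_rich_whp\<close> asks for.\<close>
  define C where "C = 2 * (real r + 1) / \<epsilon> ^ r"
  have \<eta>: "0 < \<eta>" "\<eta> \<le> 1" unfolding \<eta>_def using \<alpha> \<alpha>1 by (auto intro: power_le_one)
  have "\<eta> * \<alpha> \<le> 1 * 1" using \<eta> \<alpha> \<alpha>1 by (intro mult_mono) auto
  then have \<epsilon>: "0 < \<epsilon>" "\<epsilon> \<le> 1 / 2" using \<eta> \<alpha> by (simp_all add: \<epsilon>_def mult_ac)
  have \<epsilon>r: "0 < \<epsilon> ^ r" "\<epsilon> ^ r \<le> 1" using \<epsilon> by (auto intro: power_le_one)
  have C1: "1 \<le> C" using \<epsilon>r by (simp add: C_def divide_simps)
  have "0 < r choose 2" using r by (simp add: zero_less_binomial)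
  then have "C \<le> C ^ (r choose 2)" using C1 by (intro self_le_power) auto
  then have "\<epsilon> ^ r * C \<le> \<epsilon> ^ r * C ^ (r choose 2)" using \<epsilon>r by (intro mult_left_mono) auto
  moreover have "\<epsilon> ^ r * C = 2 * (real r + 1)" using \<epsilon>(1) by (simp add: C_def)
  ultimately have "2 * (real r + 1) \<le> \<epsilon> ^ r * C ^ (r choose 2)" by (simp only:)
  then have C: "real r + 1 \<le> \<epsilon> ^ r * C ^ (r choose 2) / 2"
    by (simp only: le_divide_eq_numeral1 mult.commute)
  have "whp (\<lambda>n. random_partite_graph r n (p n)) (\<lambda>n H. has_perfect_tiling r (verts r n) (G n \<union> H))"
    if p01: "\<And>n. 0 \<le> p n \<and> p n \<le> 1"
      and p: "\<forall>\<^sub>F n in sequentially. p n \<ge> C * real n powr (- 2 / real r)"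
      and G: "\<And>n. G n \<in> partite_graphs r \<alpha> n" for p G
    unfolding whp_iff_prob_not_tendsto_0
  proof (rule tendsto_sandwich[OF _ _ tendsto_const])
    let ?s = "\<lambda>n. nat \<lceil>\<epsilon> * real n\<rceil>"
    let ?rich = "\<lambda>n. measure_pmf.prob (random_partite_graph r n (p n)) {H. \<not> clique_rich r n (?s n) H}"
    have "(\<lambda>n. ?rich n + real r * real r * (real n * exp (- 2 * \<epsilon>) ^ n)) \<longlonglongrightarrow> 0 + real r * real r * 0"
    proof (intro tendsto_intros)
      show "?rich \<longlonglongrightarrow> 0" using r C1 \<epsilon> by (intro clique_rich_whp[OF _ _ _ C p01 p]) auto
      show "(\<lambda>n. real n * exp (- 2 * \<epsilon>) ^ n) \<longlonglongrightarrow> 0"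
        using \<epsilon> by (intro powser_times_n_limit_0) simp
    qed
    then show "(\<lambda>n. ?rich n + real r * real r * (real n * exp (- 2 * \<epsilon>) ^ n)) \<longlonglongrightarrow> 0" by simp
    show "\<forall>\<^sub>F n in sequentially. measure_pmf.prob (random_partite_graph r n (p n))
        {H. \<not> has_perfect_tiling r (verts r n) (G n \<union> H)} \<le>
      ?rich n + real r * real r * (real n * exp (- 2 * \<epsilon>) ^ n)"
      \<comment> \<open>From here on \<open>\<eta> * \<alpha> * n \<ge> 8\<close>, which absorbs the
        rounding in \<open>a\<close> and \<open>?s n\<close>.\<close>
      using eventually_ge_at_top[of "nat \<lceil>8 / (\<eta> * \<alpha>)\<rceil> + 1"]
    proof eventually_elim
      case (elim n)
      have n: "0 < n" "8 / (\<eta> * \<alpha>) \<le> real n" using elim by linarith+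
      then have n8: "8 \<le> \<eta> * \<alpha> * real n" using \<eta> \<alpha> by (simp add: field_simps)
      define a where "a = nat \<lfloor>\<alpha> / 2 * real n\<rfloor>"
      have "0 \<le> \<alpha> / 2 * real n" using \<alpha> by simp
      then have a: "real a \<le> \<alpha> / 2 * real n" "\<alpha> / 2 * real n - 1 \<le> real a"
        unfolding a_def by linarith+
      have "0 < \<epsilon> * real n" using \<epsilon> n by simp
      then have s: "0 < ?s n" "\<epsilon> * real n \<le> real (?s n)" "real (?s n) \<le> \<epsilon> * real n + 1" by linarith+
      have "\<eta> * (\<alpha> / 2 * real n - 1) \<le> \<eta> * real a" using a \<eta> by (intro mult_left_mono) auto
      then have big: "2 * real (?s n) \<le> \<eta> * real a"
        using s(3) n8 \<eta> by (simp add: \<epsilon>_def algebra_simps)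
      \<comment> \<open>As \<open>r * \<alpha> < 1\<close>, the blocks take up at most half of the
        indices; \<open>\<epsilon> \<le> 1 / 2\<close> fits \<open>?s n\<close> into the other half,
        up to the extra 1.\<close>
      have fits: "r * a + ?s n \<le> n + 1"
      proof -
        have "real r * real a \<le> real r * (\<alpha> / 2 * real n)" using a by (intro mult_left_mono) auto
        also have "\<dots> = (real r * \<alpha>) * (real n / 2)" by simp
        also have "\<dots> \<le> 1 * (real n / 2)" using r\<alpha> by (intro mult_right_mono) auto
        finally have "real r * real a \<le> real n / 2" by simp
        moreover have "\<epsilon> * real n \<le> 1 / 2 * real n" using \<epsilon> by (intro mult_right_mono) auto
        ultimately have "real (r * a + ?s n) \<le> real (n + 1)" using s(3) by simp
        then show ?thesis by (simp only: of_nat_le_iff)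
      qed
      have e: "exp (- ((\<alpha> / 8) ^ r * real a)) \<le> exp (- 2 * \<epsilon>) ^ n"
        using big s(2) by (simp add: \<eta>_def algebra_simps flip: exp_of_nat_mult)
      have "measure_pmf.prob (random_partite_graph r n (p n))
          {H. \<not> has_perfect_tiling r (verts r n) (G n \<union> H)} \<le>
        ?rich n + real r * real n * (real r * exp (- ((\<alpha> / 8) ^ r * real a)))"
        using \<alpha> \<alpha>1 s(1) fits a(1) big
        by (intro prob_no_perfect_tiling_le[OF G]) (auto simp: \<eta>_def)
      also have "\<dots> \<le> ?rich n + real r * real n * (real r * exp (- 2 * \<epsilon>) ^ n)"
        by (intro add_left_mono mult_left_mono e) auto
      finally show ?case by (simp only: mult_ac)
    qed
  qed simp
  then show ?thesis using C1 by (intro exI[of _ C]) auto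
qed

section \<open>Below the threshold\<close>

text \<open>Only edge-disjointness is recorded: it already makes the presences of the cliques in the
  random graph independent.\<close>

definition disjoint_cliques :: "nat \<Rightarrow> nat \<Rightarrow> nat \<Rightarrow> (nat \<Rightarrow> nat) set set" where
  "disjoint_cliques r n m = {D. D \<subseteq> PiE {..<r} (\<lambda>_. {..<n}) \<and> card D = m \<and>
     (\<forall>f\<in>D. \<forall>g\<in>D. f \<noteq> g \<longrightarrow> tile_edges r f \<inter> tile_edges r g = {})}"

text \<open>First moment: a family of \<open>m\<close> edge-disjoint cliques has
  \<open>m * (r choose 2)\<close> edges, and there are at most \<open>n ^ r choose m\<close>
  families.\<close>

lemma prob_disjoint_cliques_le:
  assumes p: "0 \<le> p" "p \<le> 1"
  shows "measure_pmf.prob (random_partite_graph r n p)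
      {H. \<exists>D\<in>disjoint_cliques r n m. \<forall>f\<in>D. tile_edges r f \<subseteq> H}
    \<le> real (n ^ r choose m) * (p ^ (r choose 2)) ^ m"
proof -
  let ?F = "PiE {..<r} (\<lambda>_. {..<n})" and ?R = "random_partite_graph r n p"
  have finF: "finite ?F" by (intro finite_PiE) auto
  have sub: "disjoint_cliques r n m \<subseteq> {D. D \<subseteq> ?F \<and> card D = m}"
    by (auto simp: disjoint_cliques_def)
  have fin': "finite {D. D \<subseteq> ?F \<and> card D = m}" using finF by simp
  have fin: "finite (disjoint_cliques r n m)" by (rule finite_subset[OF sub fin'])
  have prob: "measure_pmf.prob ?R {H. \<forall>f\<in>D. tile_edges r f \<subseteq> H} = (p ^ (r choose 2)) ^ m"
    if D: "D \<in> disjoint_cliques r n m" for D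
  proof -
    have "finite D" using D finF by (auto simp: disjoint_cliques_def intro: finite_subset)
    then have "card (\<Union>f\<in>D. tile_edges r f) = (r choose 2) * m"
      using D by (subst card_UN_disjoint)
        (auto simp: disjoint_cliques_def finite_tile_edges card_tile_edges mult.commute)
    moreover have "(\<Union>f\<in>D. tile_edges r f) \<subseteq> cross_pairs r n"
    proof (rule UN_least)
      fix f assume "f \<in> D"
      then have "f \<in> ?F" using D by (auto simp: disjoint_cliques_def)
      then show "tile_edges r f \<subseteq> cross_pairs r n"
        by (intro tile_edges_subset_cross_pairs) (auto simp: PiE_iff)
    qed
    moreover have "{H. \<forall>f\<in>D. tile_edges r f \<subseteq> H} = {H. (\<Union>f\<in>D. tile_edges r f) \<subseteq> H}"
      by blast
    ultimately show ?thesis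
      unfolding random_partite_graph_eq
      by (simp only: prob_random_subset_superset'[OF p finite_cross_pairs] power_mult)
  qed
  have "measure_pmf.prob ?R {H. \<exists>D\<in>disjoint_cliques r n m. \<forall>f\<in>D. tile_edges r f \<subseteq> H} =
      measure_pmf.prob ?R (\<Union>D\<in>disjoint_cliques r n m. {H. \<forall>f\<in>D. tile_edges r f \<subseteq> H})"
    by (rule arg_cong[where f = "measure _"]) blast
  also have "\<dots> \<le> (\<Sum>D\<in>disjoint_cliques r n m. measure_pmf.prob ?R {H. \<forall>f\<in>D. tile_edges r f \<subseteq> H})"
    using fin by (intro measure_pmf.finite_measure_subadditive_finite) auto
  also have "\<dots> = real (card (disjoint_cliques r n m)) * (p ^ (r choose 2)) ^ m"
    by (simp add: prob)
  also have "\<dots> \<le> real (n ^ r choose m) * (p ^ (r choose 2)) ^ m"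
  proof -
    have "card (disjoint_cliques r n m) \<le> card {D. D \<subseteq> ?F \<and> card D = m}"
      by (rule card_mono[OF fin' sub])
    also have "\<dots> = n ^ r choose m" using n_subsets[OF finF] by (simp add: card_PiE)
    finally show ?thesis using p by (intro mult_right_mono) auto
  qed
  finally show ?thesis .
qed

section \<open>The extremal graph and its perfect tilings\<close>

text \<open>The dominating set \<open>A\<close> consists of the first \<open>a\<close> vertices of
  every class, so membership is a test on the second coordinate.\<close>

definition dominated_graph :: "nat \<Rightarrow> nat \<Rightarrow> nat \<Rightarrow> vertex set set" where
  "dominated_graph r n a = {e \<in> cross_pairs r n. \<exists>v\<in>e. snd v < a}"

lemma dominated_graph_in_partite_graphs:
  assumes "2 \<le> r" "0 \<le> \<alpha>" "\<alpha> \<le> 1"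
  shows "dominated_graph r n (nat \<lceil>\<alpha> * real n\<rceil>) \<in> partite_graphs r \<alpha> n"
\<comment> \<open>For \<open>n = 0\<close> the classes are empty and \<open>Min\<close> has no
  meaningful value, but the required bound is \<open>0\<close>.\<close>
proof (cases "n = 0")
  case True
  then show ?thesis by (auto simp: partite_graphs_def dominated_graph_def)
next
  case False
  let ?a = "nat \<lceil>\<alpha> * real n\<rceil>"
  have "\<alpha> * real n \<le> 1 * real n" using assms by (intro mult_right_mono) auto
  then have a: "?a \<le> n" by linarith
  have "?a \<le> delta_star r n (dominated_graph r n ?a)"
  proof (rule le_delta_star)
    fix i j x assume ijx: "i < r" "j < r" "i \<noteq> j" "x < n"
    have "{(i, x), (j, y)} \<in> dominated_graph r n ?a" if "y < ?a" for y
    proof -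
      have "y < n" using that a by linarith
      with ijx have "{(i, x), (j, y)} \<in> cross_pairs r n" unfolding mem_cross_pairs_iff by blast
      with that show ?thesis by (simp add: dominated_graph_def)
    qed
    then have "{..<?a} \<subseteq> {y. y < n \<and> {(i, x), (j, y)} \<in> dominated_graph r n ?a}"
      unfolding subset_iff lessThan_iff mem_Collect_eq using less_le_trans[OF _ a] by blast
    then have "card {..<?a} \<le> card {y. y < n \<and> {(i, x), (j, y)} \<in> dominated_graph r n ?a}"
      by (intro card_mono) auto
    then show "?a \<le> card {y. y < n \<and> {(i, x), (j, y)} \<in> dominated_graph r n ?a}" by simp
  qed (use False assms in auto)
  then have "\<alpha> * real n \<le> real (delta_star r n (dominated_graph r n ?a))" by linarith
  then show ?thesis by (auto simp: partite_graphs_def dominated_graph_def)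
qed

text \<open>No edge lies inside a class, so the \<open>r\<close> vertices of the clique are in
  distinct classes and meet all \<open>r\<close> of them.\<close>

lemma spans_complete_transversal:
  assumes K: "spans_complete r E K" "K \<subseteq> verts r n" and E: "E \<subseteq> cross_pairs r n"
  shows "\<exists>f\<in>PiE {..<r} (\<lambda>_. {..<n}). K = (\<lambda>i. (i, f i)) ` {..<r}"
proof -
  have cardK: "card K = r" and edge: "\<And>u v. u \<in> K \<Longrightarrow> v \<in> K \<Longrightarrow> u \<noteq> v \<Longrightarrow> {u, v} \<in> cross_pairs r n"
    using K E unfolding spans_complete_def by blast+
  have inj: "inj_on fst K"
  proof (rule inj_onI)
    fix u v assume uv: "u \<in> K" "v \<in> K" "fst u = fst v"
    show "u = v"
    proof (rule ccontr)
      assume "u \<noteq> v"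
      then obtain i j x y where "i \<noteq> j" "{u, v} = {(i, x), (j, y)}"
        using edge[OF uv(1,2)] by (auto simp: mem_cross_pairs_iff)
      with uv(3) show False by (auto simp: doubleton_eq_iff)
    qed
  qed
  have "fst ` K \<subseteq> {..<r}" using K(2) by (auto simp: verts_def vclass_def)
  moreover have "card (fst ` K) = card {..<r}" using cardK by (simp add: card_image[OF inj])
  ultimately have fstK: "fst ` K = {..<r}" by (intro card_subset_eq) auto
  define f where "f = restrict (\<lambda>i. snd (the_inv_into K fst i)) {..<r}"
  have f: "(i, f i) \<in> K" if "i < r" for i
    using the_inv_into_into[OF inj, of i K] f_the_inv_into_f[OF inj, of i] fstK that
    by (auto simp: f_def prod_eq_iff) (metis lessThan_iff prod.collapse)
  have "K = (\<lambda>i. (i, f i)) ` {..<r}"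
  proof
    show "(\<lambda>i. (i, f i)) ` {..<r} \<subseteq> K" using f by auto
    show "K \<subseteq> (\<lambda>i. (i, f i)) ` {..<r}"
    proof
      fix v assume v: "v \<in> K"
      then have "fst v < r" using fstK by auto
      moreover from this have "v = (fst v, f (fst v))"
        using v f[of "fst v"] inj_onD[OF inj, of v "(fst v, f (fst v))"] by simp
      ultimately show "v \<in> (\<lambda>i. (i, f i)) ` {..<r}" by blast
    qed
  qed
  moreover have "f \<in> PiE {..<r} (\<lambda>_. {..<n})"
    using f K(2) by (auto simp: f_def verts_def vclass_def)
  ultimately show ?thesis by blast
qed

text \<open>Only \<open>r * a\<close> tiles of a perfect tiling can use an edge of \<open>dominated_graph r n a\<close>.\<close>

lemma disjoint_cliques_of_perfect_tiling:
  assumes r: "0 < r" and H: "H \<subseteq> cross_pairs r n"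
    and tiling: "has_perfect_tiling r (verts r n) (dominated_graph r n a \<union> H)"
  shows "\<exists>D\<in>disjoint_cliques r n (n - r * a). \<forall>f\<in>D. tile_edges r f \<subseteq> H"
proof -
  let ?E = "dominated_graph r n a \<union> H"
  from tiling obtain T where T: "\<And>K. K \<in> T \<Longrightarrow> spans_complete r ?E K" "disjoint T" "\<Union>T = verts r n"
    by (auto simp: has_perfect_tiling_def)
  have E: "?E \<subseteq> cross_pairs r n" using H by (auto simp: dominated_graph_def)
  have finT: "finite T" using T(3) finite_verts finite_UnionD by metis
  have cardK: "card K = r" "finite K" if "K \<in> T" for K
    using T(1)[OF that] r by (auto simp: spans_complete_def card_ge_0_finite)
  have "card (verts r n) = r * n"
    unfolding verts_def by (subst card_UN_disjoint) (auto simp: vclass_def)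
  moreover have "card (\<Union>T) = (\<Sum>K\<in>T. card K)"
    using T(2) cardK by (intro card_Union_disjoint) (auto simp: disjoint_def pairwise_def disjnt_def)
  ultimately have cardT: "card T = n" using T(3) r cardK(1) by (simp add: mult.commute)
  have "\<forall>K\<in>T. \<exists>f\<in>PiE {..<r} (\<lambda>_. {..<n}). K = (\<lambda>i. (i, f i)) ` {..<r}"
    using T(1,3) E by (intro ballI spans_complete_transversal) auto
  then obtain F where F: "\<And>K. K \<in> T \<Longrightarrow> F K \<in> PiE {..<r} (\<lambda>_. {..<n})"
    "\<And>K. K \<in> T \<Longrightarrow> K = (\<lambda>i. (i, F K i)) ` {..<r}"
    by metis
  \<comment> \<open>Tiles meeting \<open>A\<close> are counted by choosing a vertex of
    \<open>A\<close> in each; disjoint tiles give distinct vertices, of which there are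
    \<open>r * a\<close>.\<close>
  define T1 where "T1 = {K \<in> T. \<exists>v\<in>K. snd v < a}"
  have "card T1 \<le> card ({..<r} \<times> {..<a})"
  proof -
    have "\<forall>K\<in>T1. \<exists>v. v \<in> K \<and> snd v < a" unfolding T1_def by blast
    then obtain v where v: "\<And>K. K \<in> T1 \<Longrightarrow> v K \<in> K \<and> snd (v K) < a" by metis
    have "inj_on v T1"
    proof (rule inj_onI)
      fix K L assume KL: "K \<in> T1" "L \<in> T1" "v K = v L"
      then have "K \<inter> L \<noteq> {}" using v[of K] v[of L] by auto
      then show "K = L" using T(2) KL by (auto simp: disjoint_def T1_def)
    qed
    moreover have "v ` T1 \<subseteq> {..<r} \<times> {..<a}"
    proof
      fix w assume "w \<in> v ` T1"
      then obtain K where K: "K \<in> T1" "w = v K" by blast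
      then have "w \<in> verts r n" using v[of K] T(3) by (auto simp: T1_def)
      then show "w \<in> {..<r} \<times> {..<a}" using v[OF K(1)] K(2) by (auto simp: verts_def vclass_def)
    qed
    ultimately show ?thesis by (intro card_inj_on_le) auto
  qed
  then have "n - r * a \<le> card (T - T1)"
    using cardT finT by (subst card_Diff_subset) (auto simp: T1_def intro: finite_subset)
  then obtain D' where D': "D' \<subseteq> T - T1" "card D' = n - r * a"
    by (metis obtain_subset_with_card_n)
  have "inj_on F D'"
  proof (rule inj_onI)
    fix K L assume "K \<in> D'" "L \<in> D'" "F K = F L"
    then show "K = L" using F(2)[of K] F(2)[of L] D'(1) by auto
  qed
  then have "card (F ` D') = n - r * a" using D'(2) by (simp add: card_image)
  moreover have "F ` D' \<subseteq> PiE {..<r} (\<lambda>_. {..<n})" using F(1) D'(1) by blast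
  moreover have "tile_edges r (F K) \<inter> tile_edges r (F L) = {}"
    if KL: "K \<in> D'" "L \<in> D'" "F K \<noteq> F L" for K L
  proof (rule ccontr)
    have edge: "e \<subseteq> K \<and> e \<noteq> {}" if "e \<in> tile_edges r (F K)" "K \<in> D'" for e K
      using that F(2)[of K] D'(1) by (subst (asm) mem_tile_edges_iff) blast
    assume "\<not> ?thesis"
    then obtain e where "e \<in> tile_edges r (F K)" "e \<in> tile_edges r (F L)" by blast
    then have "K \<inter> L \<noteq> {}" using edge[of e K] edge[of e L] KL by blast
    moreover have "K \<in> T" "L \<in> T" "K \<noteq> L" using KL D'(1) by auto
    ultimately show False using T(2) by (auto simp: disjoint_def)
  qed
  moreover have "tile_edges r (F K) \<subseteq> H" if K: "K \<in> D'" for K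
    unfolding tile_edges_subset_iff
  proof (intro allI impI)
    fix i j assume ij: "i < r" "j < r" "i \<noteq> j"
    have "K \<in> T" "K \<notin> T1" using K D'(1) by auto
    moreover have "(i, F K i) \<in> K" "(j, F K j) \<in> K"
      using F(2)[OF \<open>K \<in> T\<close>] ij by blast+
    ultimately have "{(i, F K i), (j, F K j)} \<in> ?E" "\<not> F K i < a" "\<not> F K j < a"
      using T(1)[of K] ij by (auto simp: spans_complete_def T1_def)
    then show "{(i, F K i), (j, F K j)} \<in> H" by (auto simp: dominated_graph_def)
  qed
  ultimately show ?thesis
    by (intro bexI[of _ "F ` D'"]) (auto simp: disjoint_cliques_def)
qed

section \<open>Constants and limits below the threshold\<close>

text \<open>\<open>m ^ m / fact m\<close> is a single term of the exponential series of
  \<open>exp m\<close>.\<close>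

lemma binomial_le_exp_power:
  assumes "0 < m"
  shows "real (N choose m) \<le> (exp 1 * real N / real m) ^ m"
proof -
  have "(\<Sum>k\<in>{m}. real m ^ k /\<^sub>R fact k) \<le> (\<Sum>k. real m ^ k /\<^sub>R fact k)"
    using summable_exp_generic[of "real m"] by (intro sum_le_suminf) auto
  then have "real m ^ m / fact m \<le> exp (real m)"
    by (simp add: exp_def divide_inverse mult.commute)
  then have fact: "real m ^ m \<le> exp 1 ^ m * fact m"
    by (simp add: field_simps flip: exp_of_nat_mult)
  have "real (N choose m) * real m ^ m \<le> real (N choose m) * (exp 1 ^ m * fact m)"
    by (intro mult_left_mono fact) auto
  also have "\<dots> = exp 1 ^ m * real ((N choose m) * fact m)" by simp
  also have "\<dots> \<le> exp 1 ^ m * real (N ^ m)"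
    using binomial_fact_pow[of N m] by (intro mult_left_mono) (simp_all only: of_nat_le_iff, simp)
  finally show ?thesis
    using assms by (simp add: power_divide power_mult_distrib field_simps)
qed

text \<open>The first moment is at most \<open>(exp 1 * n ^ r * p ^ (r choose 2) / m) ^ m\<close>.
  Here \<open>n ^ r * p ^ (r choose 2)\<close> is at most \<open>c * n\<close> while
  \<open>m\<close> is at least \<open>\<delta> * n\<close>, so a small \<open>c\<close> makes the
  base at most \<open>1 / 2\<close>.\<close>

lemma no_perfect_tiling_whp:
  assumes r: "r \<ge> 2" and \<alpha>: "0 < \<alpha>" "\<alpha> < 1 / real r"
  shows "\<exists>c>0. \<forall>p. (\<forall>n. 0 \<le> p n \<and> p n \<le> 1) \<and>
      (\<forall>\<^sub>F n in sequentially. p n \<le> c * real n powr (- 2 / real r)) \<longrightarrow>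
    (\<exists>G. (\<forall>n. G n \<in> partite_graphs r \<alpha> n) \<and>
      whp (\<lambda>n. random_partite_graph r n (p n)) (\<lambda>n H. \<not> has_perfect_tiling r (verts r n) (G n \<union> H)))"
proof -
  have r\<alpha>: "real r * \<alpha> < 1" using \<alpha> r by (simp add: field_simps)
  have \<alpha>1: "\<alpha> \<le> 1"
  proof -
    have "1 * \<alpha> \<le> real r * \<alpha>" using r \<alpha> by (intro mult_right_mono) auto
    then show ?thesis using r\<alpha> by simp
  qed
  \<comment> \<open>Up to rounding, \<open>(1 - r * \<alpha>) * n = 2 * \<delta> * n\<close> tiles
    avoid \<open>A\<close>; half of this pays for the rounding of \<open>?a\<close> in the
    \<open>r\<close> classes.\<close>
  define \<delta> where "\<delta> = (1 - real r * \<alpha>) / 2"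
  define c where "c = \<delta> / (2 * exp 1)"
  have "0 \<le> real r * \<alpha>" using \<alpha> by simp
  then have \<delta>: "0 < \<delta>" "\<delta> \<le> 1" unfolding \<delta>_def using r\<alpha> by (auto intro: order_trans[of _ 0])
  have "(1::real) \<le> 2 * exp 1" using exp_ge_add_one_self[of 1] by simp
  then have c: "0 < c" "c \<le> 1" using \<delta> by (auto simp: c_def divide_simps)
  define G where "G = (\<lambda>n. dominated_graph r n (nat \<lceil>\<alpha> * real n\<rceil>))"
  have "whp (\<lambda>n. random_partite_graph r n (p n)) (\<lambda>n H. \<not> has_perfect_tiling r (verts r n) (G n \<union> H))"
    if p01: "\<And>n. 0 \<le> p n \<and> p n \<le> 1"
      and p: "\<forall>\<^sub>F n in sequentially. p n \<le> c * real n powr (- 2 / real r)" for p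
    unfolding whp_iff_prob_not_tendsto_0 not_not
  proof (rule tendsto_sandwich[OF _ _ tendsto_const])
    show "(\<lambda>n. (1 / \<delta>) / real n) \<longlonglongrightarrow> 0" by (rule lim_const_over_n)
    show "\<forall>\<^sub>F n in sequentially. measure_pmf.prob (random_partite_graph r n (p n))
        {H. has_perfect_tiling r (verts r n) (G n \<union> H)} \<le> (1 / \<delta>) / real n"
      using p eventually_ge_at_top[of "nat \<lceil>real r / \<delta>\<rceil> + 1"]
    proof eventually_elim
      case (elim n)
      let ?a = "nat \<lceil>\<alpha> * real n\<rceil>" and ?R = "random_partite_graph r n (p n)" and ?t = "r choose 2"
      define m where "m = n - r * ?a"
      have n: "0 < n" "real r / \<delta> \<le> real n" using elim(2) by linarith+
      have "real ?a \<le> \<alpha> * real n + 1" using \<alpha> by (simp add: of_nat_nat)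
      then have 1: "real r * real ?a \<le> real r * (\<alpha> * real n + 1)" by (intro mult_left_mono) auto
      have 2: "real r \<le> \<delta> * real n" using n \<delta> by (simp add: field_simps)
      have r\<alpha>_eq: "real r * \<alpha> = 1 - 2 * \<delta>" by (simp add: \<delta>_def field_simps)
      have "real r * (\<alpha> * real n + 1) = (real r * \<alpha>) * real n + real r" by (simp add: algebra_simps)
      also have "\<dots> = real n - 2 * (\<delta> * real n) + real r"
        unfolding r\<alpha>_eq by (simp add: left_diff_distrib)
      finally have "\<delta> * real n \<le> real n - real (r * ?a)"
        using 1 2 unfolding of_nat_mult by linarith
      also have "\<dots> \<le> real m" unfolding m_def by linarith
      finally have m: "\<delta> * real n \<le> real m" .
      moreover have \<delta>n: "0 < \<delta> * real n" using \<delta> n by simp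
      ultimately have m0: "0 < m" by linarith
      \<comment> \<open>\<open>disjoint_cliques_of_perfect_tiling\<close> needs \<open>H\<close> to
        be \<open>r\<close>-partite, which holds on the support.\<close>
      have "set_pmf ?R \<subseteq> {H. H \<subseteq> cross_pairs r n}"
        by (auto simp: random_partite_graph_def)
      then have "measure_pmf.prob ?R {H. has_perfect_tiling r (verts r n) (G n \<union> H)} \<le>
          measure_pmf.prob ?R {H. \<exists>D\<in>disjoint_cliques r n m. \<forall>f\<in>D. tile_edges r f \<subseteq> H}"
        using disjoint_cliques_of_perfect_tiling[of r _ n ?a] r
        by (subst measure_Int_set_pmf[symmetric], intro measure_pmf.finite_measure_mono)
           (auto simp: m_def G_def)
      also have "\<dots> \<le> real (n ^ r choose m) * (p n ^ ?t) ^ m"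
        using p01[of n] by (intro prob_disjoint_cliques_le) auto
      also have "\<dots> \<le> (exp 1 * real (n ^ r) / real m) ^ m * (p n ^ ?t) ^ m"
        using p01[of n] by (intro mult_right_mono binomial_le_exp_power m0) auto
      also have "\<dots> = (exp 1 * (real n ^ r * p n ^ ?t) / real m) ^ m"
        by (simp add: mult.assoc power_mult_distrib[symmetric])
      also have "\<dots> \<le> (1 / 2) ^ m"
      proof (rule power_mono)
        have "real n ^ r * p n ^ ?t \<le> real n ^ r * (c * real n powr (- 2 / real r)) ^ ?t"
          using p01[of n] elim(1) by (intro mult_left_mono power_mono) auto
        also have "\<dots> = c ^ ?t * real n" using n r by (intro power_choose_two_scaling) auto
        also have "\<dots> \<le> c ^ 1 * real n"
          using c r by (intro mult_right_mono power_decreasing) (auto simp: Suc_le_eq zero_less_binomial)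
        finally have "exp 1 * (real n ^ r * p n ^ ?t) \<le> exp 1 * (c * real n)"
          by (intro mult_left_mono) auto
        also have "\<dots> = \<delta> * real n / 2" by (simp add: c_def)
        also have "\<dots> \<le> real m / 2" using m by simp
        finally show "exp 1 * (real n ^ r * p n ^ ?t) / real m \<le> 1 / 2"
          using m0 by (simp add: field_simps)
        show "0 \<le> exp 1 * (real n ^ r * p n ^ ?t) / real m" using p01[of n] by simp
      qed
      \<comment> \<open>The crude bound \<open>m < 2 ^ m\<close> suffices, as only convergence to
        \<open>0\<close> is wanted.\<close>
      also have "\<dots> \<le> 1 / real m"
        using of_nat_less_two_power[of m, where ?'a = real] m0 by (simp add: power_divide field_simps)
      also have "\<dots> \<le> 1 / (\<delta> * real n)" using m \<delta>n by (intro divide_left_mono) auto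
      finally show ?case by simp
    qed
  qed simp
  moreover have "G n \<in> partite_graphs r \<alpha> n" for n
    unfolding G_def using r \<alpha> \<alpha>1 by (intro dominated_graph_in_partite_graphs) auto
  ultimately show ?thesis using c by (intro exI[of _ c]) blast
qed

theorem theorem1p5:
  fixes r :: nat and \<alpha> :: real
  assumes "r \<ge> 3" and "0 < \<alpha>" and "\<alpha> < 1 / real r"
  shows "threshold_function r (partite_graphs r \<alpha>)
           (\<lambda>n. has_perfect_tiling r (verts r n)) (\<lambda>n. real n powr (- 2 / real r))"
proof -
  have "r \<ge> 2" using assms(1) by simp
  from perfect_tiling_whp[OF this assms(2,3)] no_perfect_tiling_whp[OF this assms(2,3)]
  show ?thesis unfolding threshold_function_def by blast
qed

end
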